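(* Let $m\neq 0$ be a real number with $m\neq 1$, and let $S$ be a surface in Euclidean space $\mathbb{R}^3$ whose principal curvatures $\kappa_1\ge\kappa_2$ satisfy $\kappa_1=m\,\kappa_2$ at every point. Suppose $S$ is a cyclic surface, i.e. $S$ is determined by a smooth one-parameter family of pieces of circles. Then the planes containing the circles of this family are parallel.
   Context: For a surface in $\mathbb{R}^3$ with mean curvature $H$ and Gauss curvature $K$, the principal curvatures are $\kappa_1=H+\sqrt{H^2-K}$ and $\kappa_2=H-\sqrt{H^2-K}$. A linear Weingarten surface (LW-surface) is a surface satisfying $\kappa_1=m\kappa_2+n$ for real constants $m,n$ with $m\neq 0$, the umbilical case $(m,n)=(1,0)$ being excluded. A cyclic surface is a surface determined (foliated) by a smooth one-parameter family of pieces of circles; the statement is local. *)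

theory Defs
  imports "HOL-Analysis.Analysis"
begin

definition smooth_real_on :: "real set \<Rightarrow> (real \<Rightarrow> real) \<Rightarrow> bool" where
  "smooth_real_on U g \<longleftrightarrow> (\<forall>k. \<forall>x\<in>U. ((deriv ^^ k) g) differentiable (at x))"

definition smooth_curve_on :: "real set \<Rightarrow> (real \<Rightarrow> real^3) \<Rightarrow> bool" where
  "smooth_curve_on U f \<longleftrightarrow> (\<forall>i. smooth_real_on U (\<lambda>x. f x $ i))"

definition Xs :: "(real \<Rightarrow> real \<Rightarrow> real^3) \<Rightarrow> real \<Rightarrow> real \<Rightarrow> real^3" where
  "Xs X s t = vector_derivative (\<lambda>u. X u t) (at s)"
definition Xt :: "(real \<Rightarrow> real \<Rightarrow> real^3) \<Rightarrow> real \<Rightarrow> real \<Rightarrow> real^3" where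
  "Xt X s t = vector_derivative (\<lambda>u. X s u) (at t)"
definition Xss :: "(real \<Rightarrow> real \<Rightarrow> real^3) \<Rightarrow> real \<Rightarrow> real \<Rightarrow> real^3" where
  "Xss X s t = vector_derivative (\<lambda>u. Xs X u t) (at s)"
definition Xst :: "(real \<Rightarrow> real \<Rightarrow> real^3) \<Rightarrow> real \<Rightarrow> real \<Rightarrow> real^3" where
  "Xst X s t = vector_derivative (\<lambda>u. Xs X s u) (at t)"
definition Xtt :: "(real \<Rightarrow> real \<Rightarrow> real^3) \<Rightarrow> real \<Rightarrow> real \<Rightarrow> real^3" where
  "Xtt X s t = vector_derivative (\<lambda>u. Xt X s u) (at t)"

definition unit_normal :: "(real \<Rightarrow> real \<Rightarrow> real^3) \<Rightarrow> real \<Rightarrow> real \<Rightarrow> real^3" where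
  "unit_normal X s t = (1 / norm (cross3 (Xs X s t) (Xt X s t))) *\<^sub>R cross3 (Xs X s t) (Xt X s t)"

definition fE where "fE X s t = Xs X s t \<bullet> Xs X s t"
definition fF where "fF X s t = Xs X s t \<bullet> Xt X s t"
definition fG where "fG X s t = Xt X s t \<bullet> Xt X s t"
definition fe where "fe X s t = unit_normal X s t \<bullet> Xss X s t"
definition ff where "ff X s t = unit_normal X s t \<bullet> Xst X s t"
definition fg where "fg X s t = unit_normal X s t \<bullet> Xtt X s t"

definition mean_curv :: "(real \<Rightarrow> real \<Rightarrow> real^3) \<Rightarrow> real \<Rightarrow> real \<Rightarrow> real" where
  "mean_curv X s t =
     (fe X s t * fG X s t - 2 * ff X s t * fF X s t + fg X s t * fE X s t)
     / (2 * (fE X s t * fG X s t - (fF X s t)\<^sup>2))"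

definition gauss_curv :: "(real \<Rightarrow> real \<Rightarrow> real^3) \<Rightarrow> real \<Rightarrow> real \<Rightarrow> real" where
  "gauss_curv X s t =
     (fe X s t * fg X s t - (ff X s t)\<^sup>2) / (fE X s t * fG X s t - (fF X s t)\<^sup>2)"

definition kappa1 :: "(real \<Rightarrow> real \<Rightarrow> real^3) \<Rightarrow> real \<Rightarrow> real \<Rightarrow> real" where
  "kappa1 X s t = mean_curv X s t + sqrt ((mean_curv X s t)\<^sup>2 - gauss_curv X s t)"

definition kappa2 :: "(real \<Rightarrow> real \<Rightarrow> real^3) \<Rightarrow> real \<Rightarrow> real \<Rightarrow> real" where
  "kappa2 X s t = mean_curv X s t - sqrt ((mean_curv X s t)\<^sup>2 - gauss_curv X s t)"

text \<open>A (local) cyclic surface: X(s,t) = c(s) + r(s)(cos t e1(s) + sin t e2(s)) on an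
  open rectangle, with smooth centre curve c, smooth radius r > 0, smooth orthonormal
  frame e1, e2 of the plane of the circle, and X regular.\<close>
definition cyclic_param ::
  "real set \<Rightarrow> real set \<Rightarrow> (real \<Rightarrow> real^3) \<Rightarrow> (real \<Rightarrow> real) \<Rightarrow> (real \<Rightarrow> real^3) \<Rightarrow>
   (real \<Rightarrow> real^3) \<Rightarrow> (real \<Rightarrow> real \<Rightarrow> real^3) \<Rightarrow> bool" where
  "cyclic_param I J c r e1 e2 X \<longleftrightarrow>
     smooth_curve_on I c \<and> smooth_real_on I r \<and> smooth_curve_on I e1 \<and> smooth_curve_on I e2 \<and>
     (\<forall>s\<in>I. r s > 0 \<and> e1 s \<bullet> e1 s = 1 \<and> e2 s \<bullet> e2 s = 1 \<and> e1 s \<bullet> e2 s = 0) \<and>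
     (\<forall>s t. X s t = c s + r s *\<^sub>R (cos t *\<^sub>R e1 s + sin t *\<^sub>R e2 s)) \<and>
     (\<forall>s\<in>I. \<forall>t\<in>J. cross3 (Xs X s t) (Xt X s t) \<noteq> 0)"

end

theory Submission
  imports Defs "HOL-Complex_Analysis.Complex_Analysis"
begin

text \<open>
  On each circle the relation $\kappa_1 = m\kappa_2$ implies $4mH^2 = (1+m)^2K$, a trigonometric
  polynomial identity $m h^2 = (1+m)^2 r S k$ in the angle, which therefore holds on the whole
  complex circle $c^2+s^2=1$. Suppose the plane turns at some parameter, i.e. $N' \neq 0$. At the
  point at infinity $(1 : i : 0)$ the identity reads
  $-(m-1)^2 r^2\pi^2(a^2+r^2\pi^2)^2 = 0$, where $\pi = p+iq \neq 0$ encodes $N'$ and $a$ the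
  velocity of the centre inside the plane, so $a = \pm i r \pi$. This persists nearby and can be
  differentiated. The identity then drops in degree by two, and its new leading coefficient is
  $(25m - 6(1+m)^2)(C + i r')^2$ up to scaling, $C$ being the normal velocity of the centre.
  If $25m = 6(1+m)^2$, the identity fails at a single parameter: look at a zero of $S$ if
  $(r', C) \neq 0$, and at the angle $0$ otherwise. If $25m \neq 6(1+m)^2$, then $r' = C = 0$ on an
  interval, so also $r'' = C' = 0$, and three explicit points of the circle give a contradiction.
  Hence $N$ is constant.
\<close>

section \<open>The Weingarten relation as a trigonometric identity\<close>

text \<open>Times \<open>r^2\<close> this is the numerator \<open>l * G - 2 * f * F + g * E\<close>
  of the mean curvature, formed with the unnormalised normal. The ring is general so that one
  polynomial serves real and complex points.\<close>

definition mean_poly :: "'a::comm_ring_1 \<Rightarrow> 'a \<Rightarrow> 'a \<Rightarrow> 'a \<Rightarrow> 'a \<Rightarrow> 'a \<Rightarrow> 'a \<Rightarrow> 'a" where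
  "mean_poly r l \<mu> b P Q g = r * ((P^2 + Q^2) * l - b * \<mu> * P + g) + Q * (P^2 + Q^2 + b^2)"

text \<open>Times \<open>r^3\<close> this is the determinant \<open>l * g - f^2\<close> of the
  second fundamental form, for the same normal.\<close>

definition gauss_poly :: "'a::comm_ring_1 \<Rightarrow> 'a \<Rightarrow> 'a \<Rightarrow> 'a \<Rightarrow> 'a \<Rightarrow> 'a \<Rightarrow> 'a \<Rightarrow> 'a" where
  "gauss_poly r l \<mu> b P Q g = Q * ((P^2 + Q^2) * l + b * \<mu> * P + g) - r * \<mu>^2 * P^2"

section \<open>From real angles to the complex circle and its point at infinity\<close>

lemma complex_circle_param:
  fixes c s :: complex
  assumes "c^2 + s^2 = 1"
  obtains t where "cos t = c" "sin t = s"
proof -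
  have prod: "(c + \<i> * s) * (c - \<i> * s) = 1"
    using assms by (simp add: algebra_simps power2_eq_square)
  then have nz: "c + \<i> * s \<noteq> 0" by auto
  \<comment> \<open>On the circle \<open>c + \<i> * s\<close> has the inverse
    \<open>c - \<i> * s\<close>, so its logarithm provides a complex angle.\<close>
  define t where "t = - \<i> * Ln (c + \<i> * s)"
  have e: "exp (\<i> * t) = c + \<i> * s"
    using nz by (simp add: t_def)
  have "exp (- (\<i> * t)) = c - \<i> * s"
    using prod nz e by (simp add: exp_minus inverse_eq_divide divide_eq_eq mult.commute)
  then have "cos t = c" "sin t = s"
    using e by (simp_all add: cos_exp_eq sin_exp_eq)
  then show ?thesis by (rule that)
qed

text \<open>Identity theorem: an entire function of the angle that vanishes on a real interval
  vanishes everywhere, and complex angles reach every point of the circle.\<close>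

lemma circle_identity_extends:
  fixes F :: "complex \<Rightarrow> complex \<Rightarrow> complex"
  assumes hol: "(\<lambda>t. F (cos t) (sin t)) holomorphic_on UNIV"
    and "\<alpha> < \<beta>"
    and zero: "\<And>t::real. t \<in> {\<alpha><..<\<beta>} \<Longrightarrow> F (of_real (cos t)) (of_real (sin t)) = 0"
    and cs: "c^2 + s^2 = 1"
  shows "F c s = 0"
proof -
  define U :: "complex set" where "U = of_real ` {\<alpha><..<\<beta>}"
  define x where "x = (\<alpha> + \<beta>) / 2"
  have "x islimpt {\<alpha><..<\<beta>}"
    using \<open>\<alpha> < \<beta>\<close> by (simp add: x_def interior_limit_point)
  then have lim: "complex_of_real x islimpt U"
    unfolding U_def by (intro islimpt_isCont_image) (auto simp: eventually_at_filter)
  have all0: "F (cos w) (sin w) = 0" for w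
    by (rule analytic_continuation[OF hol open_UNIV connected_UNIV subset_UNIV UNIV_I lim])
      (use zero in \<open>auto simp: U_def cos_of_real sin_of_real\<close>)
  obtain w where "cos w = c" "sin w = s" using complex_circle_param[OF cs] .
  with all0[of w] show ?thesis by simp
qed

lemma zero_at_limit:
  fixes f :: "complex \<Rightarrow> complex"
  assumes "isCont f 0" "\<And>x. x \<noteq> 0 \<Longrightarrow> f x = 0"
  shows "f 0 = 0"
proof -
  have "(f \<longlongrightarrow> f 0) (at 0)" using assms(1) by (simp add: isCont_def)
  moreover have "(f \<longlongrightarrow> 0) (at 0)"
    by (rule tendsto_eventually) (simp add: eventually_at_filter assms(2))
  ultimately show ?thesis using tendsto_unique trivial_limit_at by blast
qed

text \<open>The triple (1 + x^2, i(1 - x^2), 2x) parametrises the conic c^2 + s^2 = w^2. For x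
  \<noteq> 0 homogeneity scales it back to w = 1; at x = 0 it is the point at infinity, where only
  top-degree terms survive.\<close>

lemma homogeneous_at_infinity:
  fixes F :: "complex \<Rightarrow> complex \<Rightarrow> complex \<Rightarrow> complex"
  assumes zero: "\<And>c s. c^2 + s^2 = 1 \<Longrightarrow> F c s 1 = 0"
    and hom: "\<And>z c s w. F (z * c) (z * s) (z * w) = z ^ d * F c s w"
    and cont: "isCont (\<lambda>x. F (1 + x^2) (\<i> * (1 - x^2)) (2 * x)) 0"
  shows "F 1 \<i> 0 = 0"
proof -
  have "F (1 + x^2) (\<i> * (1 - x^2)) (2 * x) = 0" if "x \<noteq> 0" for x
  proof -
    have "((1 + x^2) / (2*x))^2 + (\<i> * (1 - x^2) / (2*x))^2 = 1"
      using that by (simp add: power_divide power_mult_distrib field_simps) (simp add: power2_eq_square algebra_simps)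
    from zero[OF this] hom[of "2*x" "(1 + x^2) / (2*x)" "\<i> * (1 - x^2) / (2*x)" 1] that
    show ?thesis by simp
  qed
  from zero_at_limit[OF cont this] show ?thesis by simp
qed


text \<open>With $e_1' = \omega e_2 + p N$, $e_2' = -\omega e_1 + q N$ and centre velocity
  $A e_1 + B e_2 + C N$, the argument \<open>l\<close> is the normal rotation speed $p\cos t + q\sin t$,
  \<open>\<mu>\<close> its $t$-derivative, and $P N - Q u$ is the surface normal up to the factor \<open>r\<close>, where
  $u = \cos t\, e_1 + \sin t\, e_2$. The parameters \<open>r1, r2, p1, q1, A1, B1, C1\<close> are derivatives along
  $\partial_s - \omega\partial_t$, which removes \<open>\<omega>\<close> from the formulas.\<close>

definition weingarten_residual ::
  "'a::comm_ring_1 \<Rightarrow> 'a \<Rightarrow> 'a \<Rightarrow> 'a \<Rightarrow> 'a \<Rightarrow> 'a \<Rightarrow> 'a \<Rightarrow> 'a \<Rightarrow> 'a \<Rightarrow> 'a \<Rightarrow> 'a \<Rightarrow> 'a \<Rightarrow> 'a \<Rightarrow> 'a \<Rightarrow> 'a \<Rightarrow> 'a \<Rightarrow> 'a" where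
  "weingarten_residual m r r1 r2 p q p1 q1 A B A1 B1 C C1 c s =
     (let l = p * c + q * s; \<mu> = q * c - p * s; b = B * c - A * s;
          P = r1 + A * c + B * s; Q = C + r * l;
          g = P * (C1 + r1 * l + r * (p1 * c + q1 * s)) - Q * (r2 + A1 * c + B1 * s)
      in m * (mean_poly r l \<mu> b P Q g)^2
         - (1 + m)^2 * r * (P^2 + Q^2) * gauss_poly r l \<mu> b P Q g)"

lemma residual_extends:
  fixes m r r1 r2 p q p1 q1 A B A1 B1 C C1 \<alpha> \<beta> :: real and c s :: complex
  assumes "\<alpha> < \<beta>" and "c^2 + s^2 = 1"
    and zero: "\<And>t. t \<in> {\<alpha><..<\<beta>} \<Longrightarrow>
      weingarten_residual m r r1 r2 p q p1 q1 A B A1 B1 C C1 (cos t) (sin t) = 0"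
  shows "weingarten_residual (of_real m) (of_real r) (of_real r1) (of_real r2) (of_real p) (of_real q)
    (of_real p1) (of_real q1) (of_real A) (of_real B) (of_real A1) (of_real B1) (of_real C) (of_real C1) c s = 0"
proof (rule circle_identity_extends[OF _ \<open>\<alpha> < \<beta>\<close> _ \<open>c^2 + s^2 = 1\<close>, where F = "weingarten_residual _ _ _ _ _ _ _ _ _ _ _ _ _ _"])
  fix t :: real assume "t \<in> {\<alpha><..<\<beta>}"
  from zero[OF this] have "complex_of_real (weingarten_residual m r r1 r2 p q p1 q1 A B A1 B1 C C1 (cos t) (sin t)) = 0"
    by simp
  then show "weingarten_residual (of_real m) (of_real r) (of_real r1) (of_real r2) (of_real p) (of_real q)
    (of_real p1) (of_real q1) (of_real A) (of_real B) (of_real A1) (of_real B1) (of_real C) (of_real C1)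
    (complex_of_real (cos t)) (of_real (sin t)) = 0"
    by (simp only: weingarten_residual_def Let_def mean_poly_def gauss_poly_def of_real_add of_real_mult
        of_real_diff of_real_power of_real_1)
qed (unfold weingarten_residual_def Let_def mean_poly_def gauss_poly_def, intro holomorphic_intros)

text \<open>The residual is homogenised to degree 6. At infinity it is a multiple of 4m - (1 + m)^2
  = -(m - 1)^2, which is where m \<noteq> 1 enters.\<close>

lemma leading_coefficient:
  fixes m r r1 r2 p q p1 q1 A B A1 B1 C C1 :: complex
  assumes id: "\<And>c s. c^2 + s^2 = 1 \<Longrightarrow> weingarten_residual m r r1 r2 p q p1 q1 A B A1 B1 C C1 c s = 0"
    and "m \<noteq> 1" "r \<noteq> 0" "p + \<i> * q \<noteq> 0"
  shows "(A + \<i> * B)^2 + r^2 * (p + \<i> * q)^2 = 0"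
proof -
  define l where "l c s = p * c + q * s" for c s
  define \<mu> where "\<mu> c s = q * c - p * s" for c s
  define b where "b c s = B * c - A * s" for c s
  define P where "P c s w = r1 * w + A * c + B * s" for c s w
  define Q where "Q c s w = C * w + r * l c s" for c s w
  \<comment> \<open>Without the factor \<open>w\<close> this has degree 2, one less than (P^2 + Q^2)
    l; the factor makes the degrees agree and removes \<open>g\<close> at infinity.\<close>
  define g where "g c s w = w * (P c s w * (C1 * w + r1 * l c s + r * (p1 * c + q1 * s))
       - Q c s w * (r2 * w + A1 * c + B1 * s))" for c s w
  define H where "H c s w = mean_poly r (l c s) (\<mu> c s) (b c s) (P c s w) (Q c s w) (g c s w)" for c s w
  define K where "K c s w = gauss_poly r (l c s) (\<mu> c s) (b c s) (P c s w) (Q c s w) (g c s w)" for c s w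
  define F where "F c s w = m * (H c s w)^2
       - (1 + m)^2 * r * ((P c s w)^2 + (Q c s w)^2) * K c s w" for c s w
  have hl: "l (z * c) (z * s) = z * l c s" "\<mu> (z * c) (z * s) = z * \<mu> c s" "b (z * c) (z * s) = z * b c s" for z c s
    unfolding l_def \<mu>_def b_def by algebra+
  have hP: "P (z * c) (z * s) (z * w) = z * P c s w" "Q (z * c) (z * s) (z * w) = z * Q c s w" for z c s w
    unfolding P_def Q_def hl by algebra+
  have hg: "g (z * c) (z * s) (z * w) = z^3 * g c s w" for z c s w
    unfolding g_def hl hP by algebra
  have hH: "H (z * c) (z * s) (z * w) = z^3 * H c s w" for z c s w
    unfolding H_def hl hP hg mean_poly_def by algebra
  have hK: "K (z * c) (z * s) (z * w) = z^4 * K c s w" for z c s w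
    unfolding K_def hl hP hg gauss_poly_def by algebra
  have "F 1 \<i> 0 = 0"
  proof (rule homogeneous_at_infinity)
    show "F c s 1 = 0" if "c^2 + s^2 = 1" for c s
      using id[OF that]
      by (simp add: F_def H_def K_def P_def Q_def g_def l_def \<mu>_def b_def Let_def weingarten_residual_def)
    show "F (z * c) (z * s) (z * w) = z^6 * F c s w" for z c s w
      unfolding F_def hP hH hK by algebra
    show "isCont (\<lambda>x. F (1 + x^2) (\<i> * (1 - x^2)) (2 * x)) 0"
      unfolding F_def H_def K_def g_def P_def Q_def l_def \<mu>_def b_def mean_poly_def gauss_poly_def
      by (intro continuous_intros)
  qed
  define \<pi> where "\<pi> = p + \<i> * q"
  define a where "a = A + \<i> * B"
  have at: "l 1 \<i> = \<pi>" "\<mu> 1 \<i> = - \<i> * \<pi>" "b 1 \<i> = - \<i> * a" "P 1 \<i> 0 = a" "Q 1 \<i> 0 = r * \<pi>" "g 1 \<i> 0 = 0"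
    by (simp_all add: l_def \<mu>_def b_def P_def Q_def g_def \<pi>_def a_def algebra_simps)
  then have HK: "H 1 \<i> 0 = 2 * r * \<pi> * (a^2 + r^2 * \<pi>^2)" "K 1 \<i> 0 = r * \<pi>^2 * (a^2 + r^2 * \<pi>^2)"
    by (simp_all add: H_def K_def mean_poly_def gauss_poly_def algebra_simps power2_eq_square)
  from \<open>F 1 \<i> 0 = 0\<close> have "- ((m - 1)^2) * r^2 * \<pi>^2 * (a^2 + r^2 * \<pi>^2)^2 = 0"
    unfolding F_def HK at by algebra
  then show ?thesis using assms by (simp add: a_def \<pi>_def)
qed

section \<open>The tangential case\<close>

text \<open>The residual after $A = \varepsilon r q$, $B = -\varepsilon r p$, with the angle rotated
  so that $q = 0$ and lengths divided by $r\sqrt{p^2+q^2}$.\<close>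

definition normal_residual ::
  "'a::comm_ring_1 \<Rightarrow> 'a \<Rightarrow> 'a \<Rightarrow> 'a \<Rightarrow> 'a \<Rightarrow> 'a \<Rightarrow> 'a \<Rightarrow> 'a \<Rightarrow> 'a" where
  "normal_residual m \<rho> C G0 G1 G2 c s =
     (let P = \<rho> + s; Q = C + c; S = P^2 + Q^2; j = s * P + c * Q; x = S * c + (G0 + G1 * c + G2 * s)
      in m * (x + S * Q + c * j)^2 - (1 + m)^2 * S * (Q * x - s * P * j))"

text \<open>Since (A, B) is \<open>\<epsilon> * r\<close> times (q, -p), both P and Q become R times
  a shifted coordinate of the rotated angle, and the residual becomes \<open>R^6\<close> times the
  normal one. \<open>l\<close> and \<open>k\<close> are the components of (p1, q1) along and across
  (p, q); the conditions on \<open>A1\<close>, \<open>B1\<close> are the differentiated conditions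
  on \<open>A\<close>, \<open>B\<close>.\<close>

lemma normal_form:
  fixes m r r1 r2 p q p1 q1 A B A1 B1 C C1 \<epsilon> \<omega> :: complex
  assumes id: "\<And>c s. c^2 + s^2 = 1 \<Longrightarrow> weingarten_residual m r r1 r2 p q p1 q1 A B A1 B1 C C1 c s = 0"
    and e: "\<epsilon>^2 = 1" and w: "\<omega>^2 = p^2 + q^2" and nz: "r \<noteq> 0" "\<omega> \<noteq> 0"
    and A: "A = \<epsilon> * r * q" and B: "B = - \<epsilon> * r * p"
    and A1: "A1 = \<epsilon> * (r1 * q + r * q1)" and B1: "B1 = - \<epsilon> * (r1 * p + r * p1)"
    and R: "R = r * \<omega>" and l: "l = (p * p1 + q * q1) / \<omega>" and k: "k = (q * p1 - p * q1) / \<omega>"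
    and cs: "c^2 + s^2 = 1"
  shows "normal_residual m (r1 / R) (C / R)
    (r * (r1 * C1 - C * r2 + \<epsilon> * r^2 * \<omega> * k) / R^3)
    (r * (r1^2 * \<omega> + r1 * r * l + \<epsilon> * C * r * k - r * \<omega> * r2) / R^3)
    (r * (\<epsilon> * r1 * r * k + r * \<omega> * C1 - C * r1 * \<omega> - C * r * l) / R^3) c s = 0"
proof -
  have nR: "R \<noteq> 0" using nz R by simp
  \<comment> \<open>\<open>c'\<close>, \<open>s'\<close> are the original coordinates of the angle;
    this orthogonal change turns p c' + q s' into \<open>\<omega> * c\<close> and q c' - p s' into
    \<open>\<epsilon> * \<omega> * s\<close>.\<close>
  define c' where "c' = (p * c + \<epsilon> * q * s) / \<omega>"
  define s' where "s' = (q * c - \<epsilon> * p * s) / \<omega>"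
  have wc: "\<omega> * c' = p * c + \<epsilon> * q * s" "\<omega> * s' = q * c - \<epsilon> * p * s"
    and wl: "\<omega> * l = p * p1 + q * q1" "\<omega> * k = q * p1 - p * q1"
    using nz by (simp_all add: c'_def s'_def l k)
  have "\<omega>^2 * (c'^2 + s'^2) = \<omega>^2"
    using wc e w cs by algebra
  then have cs': "c'^2 + s'^2 = 1" using nz by simp
  have "\<omega> * (p * c' + q * s') = \<omega> * (\<omega> * c)" using wc w by algebra
  then have l': "p * c' + q * s' = \<omega> * c" using nz by simp
  have "\<omega> * (q * c' - p * s') = \<omega> * (\<epsilon> * \<omega> * s)" using wc w by algebra
  then have m': "q * c' - p * s' = \<epsilon> * \<omega> * s" using nz by simp
  have "\<omega>^2 * (p1 * c' + q1 * s') = \<omega>^2 * (l * c + \<epsilon> * k * s)" using wc wl by algebra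
  then have l1: "p1 * c' + q1 * s' = l * c + \<epsilon> * k * s" using nz by simp
  have "\<omega>^2 * (q1 * c' - p1 * s') = \<omega>^2 * (\<epsilon> * l * s - k * c)" using wc wl by algebra
  then have m1: "q1 * c' - p1 * s' = \<epsilon> * l * s - k * c" using nz by simp
  define P Q where "P = r1 / R + s" and "Q = C / R + c"
  have RP: "r1 = R * (P - s)" "C = R * (Q - c)" using nR by (simp_all add: P_def Q_def)
  have b': "B * c' - A * s' = - \<epsilon> * R * c" using l' A B R by algebra
  have P': "r1 + A * c' + B * s' = R * P" using m' A B R e RP by algebra
  have Q': "C + r * (\<omega> * c) = R * Q" using R RP by algebra
  have dP: "A1 * c' + B1 * s' = r1 * \<omega> * s + \<epsilon> * r * (\<epsilon> * l * s - k * c)" using m' m1 A1 B1 e by algebra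
  define G where "G = (r * (r1 * C1 - C * r2 + \<epsilon> * r^2 * \<omega> * k) / R^3)
    + (r * (r1^2 * \<omega> + r1 * r * l + \<epsilon> * C * r * k - r * \<omega> * r2) / R^3) * c
    + (r * (\<epsilon> * r1 * r * k + r * \<omega> * C1 - C * r1 * \<omega> - C * r * l) / R^3) * s"
  define g where "g = R * P * (C1 + r1 * (\<omega> * c) + r * (l * c + \<epsilon> * k * s)) - R * Q * (r2 + A1 * c' + B1 * s')"
  have G3: "R^3 * (x / R^3 + y / R^3 * c + z / R^3 * s) = x + y * c + z * s" for x y z
    using nR by (simp add: distrib_left)
  have "R^3 * G = r * (r1 * C1 - C * r2 + \<epsilon> * r^2 * \<omega> * k)
    + r * (r1^2 * \<omega> + r1 * r * l + \<epsilon> * C * r * k - r * \<omega> * r2) * c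
    + r * (\<epsilon> * r1 * r * k + r * \<omega> * C1 - C * r1 * \<omega> - C * r * l) * s"
    unfolding G_def by (rule G3)
  moreover have "g = r1 * C1 - C * r2 + \<epsilon> * r^2 * \<omega> * k
    + (r1^2 * \<omega> + r1 * r * l + \<epsilon> * C * r * k - r * \<omega> * r2) * c
    + (\<epsilon> * r1 * r * k + r * \<omega> * C1 - C * r1 * \<omega> - C * r * l) * s"
  proof -
    have "g = (r1 + R * s) * (C1 + r1 * (\<omega> * c) + r * (l * c + \<epsilon> * k * s))
      - (C + R * c) * (r2 + (r1 * \<omega> * s + \<epsilon> * r * (\<epsilon> * l * s - k * c)))"
      unfolding g_def add.assoc dP RP by algebra
    \<comment> \<open>The quadratic terms collect into c^2 + s^2 and a multiple of 1 - \<epsilon>^2,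
      so \<open>g\<close> is affine in \<open>c\<close>, \<open>s\<close>; hence just three numbers
      G0, G1, G2.\<close>
    also have "\<dots> = r1 * C1 - C * r2 + \<epsilon> * r^2 * \<omega> * k * (c^2 + s^2)
      + (r1^2 * \<omega> + r1 * r * l + \<epsilon> * C * r * k - r * \<omega> * r2) * c
      + (\<epsilon> * r1 * r * k + r * \<omega> * C1 - C * r1 * \<omega> - C * r * l * \<epsilon>^2) * s
      + r * \<omega> * r * l * c * s * (1 - \<epsilon>^2)"
      unfolding R by algebra
    finally show ?thesis using e cs by simp
  qed
  ultimately have rg: "r * g = R^3 * G" by algebra
  define S where "S = P^2 + Q^2"
  define j where "j = s * P + c * Q"
  have H: "mean_poly r (\<omega> * c) (\<epsilon> * \<omega> * s) (- \<epsilon> * R * c) (R * P) (R * Q) g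
     = R^3 * ((S * c + G) + S * Q + c * j)"
  proof -
    have "mean_poly r (\<omega> * c) (\<epsilon> * \<omega> * s) (- \<epsilon> * R * c) (R * P) (R * Q) g
      = (r * \<omega>) * R^2 * (P^2 + Q^2) * c + \<epsilon>^2 * (r * \<omega>) * R^2 * c * s * P + r * g
        + R * Q * (R^2 * (P^2 + Q^2) + \<epsilon>^2 * R^2 * c^2)"
      unfolding mean_poly_def by algebra
    then show ?thesis unfolding rg e R[symmetric] S_def j_def by algebra
  qed
  have K: "r * gauss_poly r (\<omega> * c) (\<epsilon> * \<omega> * s) (- \<epsilon> * R * c) (R * P) (R * Q) g
     = R^4 * (Q * (S * c + G) - s * P * j)"
  proof -
    have "r * gauss_poly r (\<omega> * c) (\<epsilon> * \<omega> * s) (- \<epsilon> * R * c) (R * P) (R * Q) g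
      = R * Q * ((r * \<omega>) * R^2 * (P^2 + Q^2) * c - \<epsilon>^2 * (r * \<omega>) * R^2 * c * s * P + r * g)
        - \<epsilon>^2 * (r * \<omega>)^2 * s^2 * R^2 * P^2"
      unfolding gauss_poly_def by algebra
    then show ?thesis unfolding rg e R[symmetric] S_def j_def by algebra
  qed
  have "0 = m * (mean_poly r (\<omega> * c) (\<epsilon> * \<omega> * s) (- \<epsilon> * R * c) (R * P) (R * Q) g)^2
     - (1 + m)^2 * r * ((R * P)^2 + (R * Q)^2) * gauss_poly r (\<omega> * c) (\<epsilon> * \<omega> * s) (- \<epsilon> * R * c) (R * P) (R * Q) g"
    using id[OF cs'] unfolding weingarten_residual_def Let_def l' m' b' P' Q' l1 g_def by simp
  also have "\<dots> = m * (R^3 * ((S * c + G) + S * Q + c * j))^2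
     - (1 + m)^2 * R^2 * S * (R^4 * (Q * (S * c + G) - s * P * j))"
    unfolding H K[symmetric] by (simp add: S_def) algebra
  also have "\<dots> = R^6 * (m * ((S * c + G) + S * Q + c * j)^2
     - (1 + m)^2 * S * (Q * (S * c + G) - s * P * j))"
    by algebra
  finally show ?thesis using nR
    by (simp add: normal_residual_def Let_def S_def j_def G_def P_def Q_def)
qed

text \<open>On the circle \<open>S\<close> and \<open>j\<close> are affine, so the degree is only 4.
  With y = C + i\<rho>, at infinity S = 2y, j = y, x = 2y; the mean factor becomes 5y and the Gauss
  factor 3y, whence 25 and 6 = 2 * 3.\<close>

lemma normal_leading_coefficient:
  fixes m \<rho> C G0 G1 G2 :: complex
  assumes id: "\<And>c s. c^2 + s^2 = 1 \<Longrightarrow> normal_residual m \<rho> C G0 G1 G2 c s = 0"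
  shows "(25 * m - 6 * (1 + m)^2) * (C + \<i> * \<rho>)^2 = 0"
proof -
  define S where "S c s w = (\<rho>^2 + C^2 + 1) * w + 2 * (\<rho> * s + C * c)" for c s w
  define j where "j c s w = \<rho> * s + C * c + w" for c s w
  define x where "x c s w = S c s w * c + w * (G0 * w + G1 * c + G2 * s)" for c s w
  define F where "F c s w = m * (x c s w + S c s w * (C * w + c) + c * j c s w)^2
    - (1 + m)^2 * S c s w * ((C * w + c) * x c s w - s * (\<rho> * w + s) * j c s w)" for c s w
  have hS: "S (z * c) (z * s) (z * w) = z * S c s w" "j (z * c) (z * s) (z * w) = z * j c s w" for z c s w
    unfolding S_def j_def by algebra+
  have hx: "x (z * c) (z * s) (z * w) = z^2 * x c s w" for z c s w
    unfolding x_def hS by algebra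
  have "F 1 \<i> 0 = 0"
  proof (rule homogeneous_at_infinity)
    show "F c s 1 = 0" if "c^2 + s^2 = 1" for c s
    proof -
      have S1: "(\<rho> + s)^2 + (C + c)^2 = S c s 1" and j1: "s * (\<rho> + s) + c * (C + c) = j c s 1"
        using that unfolding S_def j_def by algebra+
      show ?thesis
        using id[OF that] unfolding normal_residual_def Let_def S1 j1 by (simp add: F_def x_def)
    qed
    show "F (z * c) (z * s) (z * w) = z^4 * F c s w" for z c s w
      unfolding F_def hS hx by algebra
    show "isCont (\<lambda>x. F (1 + x^2) (\<i> * (1 - x^2)) (2 * x)) 0"
      unfolding F_def x_def S_def j_def by (intro continuous_intros)
  qed
  moreover have "F 1 \<i> 0 = (25 * m - 6 * (1 + m)^2) * (C + \<i> * \<rho>)^2"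
    unfolding F_def x_def S_def j_def by (simp add: algebra_simps power2_eq_square)
  ultimately show ?thesis by simp
qed

section \<open>Excluding the remaining cases of the reduced identity\<close>

lemma no_solution_constant:
  fixes m G :: complex
  assumes "m \<noteq> 0" and id: "\<And>c s. c^2 + s^2 = 1 \<Longrightarrow> normal_residual m 0 0 G 0 0 c s = 0"
    and "G \<in> \<real>"
  shows False
proof -
  define n where "n = (1 + m)^2"
  have "normal_residual m 0 0 G 0 0 0 1 = m * G^2 + n"
    "normal_residual m 0 0 G 0 0 1 0 = m * (3 + G)^2 - n * (1 + G)"
    "normal_residual m 0 0 G 0 0 (-1) 0 = m * (G - 3)^2 - n * (1 - G)"
    by (simp_all add: normal_residual_def n_def power2_eq_square algebra_simps)
  then have "m * G^2 + n = 0" "m * (3 + G)^2 - n * (1 + G) = 0" "m * (G - 3)^2 - n * (1 - G) = 0"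
    using id[of 0 1] id[of 1 0] id[of "-1" 0] by simp_all
  \<comment> \<open>Twice the value at angle pi/2 plus the values at 0 and pi: the terms in
    \<open>n\<close> cancel.\<close>
  then have "m * (18 + 4 * G^2) = 0" by algebra
  then have z: "18 + 4 * G^2 = 0" using \<open>m \<noteq> 0\<close> by simp
  obtain y where "G = of_real y" using \<open>G \<in> \<real>\<close> by (auto elim: Reals_cases)
  with z have "complex_of_real (18 + 4 * y^2) = 0" by simp
  then have "18 + 4 * y^2 = 0" using of_real_eq_0_iff by blast
  then show False using zero_le_power2[of y] by linarith
qed

text \<open>The angle 0 alone suffices: inserting the critical relation leaves a real quadratic in
  G0 + G1 with negative discriminant.\<close>

lemma no_solution_centred:
  fixes G0 G1 G2 :: real
  assumes "\<And>c s::complex. c^2 + s^2 = 1 \<Longrightarrow>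
    normal_residual (of_real m) 0 0 (of_real G0) (of_real G1) (of_real G2) c s = 0"
    and "m \<noteq> 0" "25 * m = 6 * (1 + m)^2"
  shows False
proof -
  define g n where "g = G0 + G1" and "n = (1 + m)^2"
  have "normal_residual (complex_of_real m) 0 0 (of_real G0) (of_real G1) (of_real G2) 1 0
      = of_real m * (of_real G0 + of_real G1 + 3)^2 - (1 + of_real m)^2 * (1 + (of_real G0 + of_real G1))"
    by (simp add: normal_residual_def power2_eq_square algebra_simps)
  then have "complex_of_real (m * (g + 3)^2 - n * (1 + g)) = 0"
    using assms(1)[of 1 0] by (simp add: g_def n_def)
  then have "m * (g + 3)^2 - n * (1 + g) = 0"
    using of_real_eq_0_iff by blast
  moreover have "25 * m = 6 * n" using assms(3) by (simp add: n_def)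
  ultimately have "m * (6 * g^2 + 11 * g + 29) = 0" by algebra
  then have "6 * g^2 + 11 * g + 29 = 0" using assms(2) by simp
  moreover have "6 * g^2 + 11 * g + 29 = 6 * (g + 11/12)^2 + 575/24"
    by (simp add: power2_eq_square algebra_simps)
  ultimately show False using zero_le_power2[of "g + 11/12"] by linarith
qed

text \<open>At a simple zero of $S = P^2 + Q^2$ the square \<open>h\<^sup>2\<close> vanishes to second order, so \<open>k\<close> must vanish
  there too, but there $k = -j^2 \neq 0$.\<close>

lemma no_solution_simple_root:
  fixes m \<rho> C G0 G1 G2 :: complex
  assumes id: "\<And>c s. c^2 + s^2 = 1 \<Longrightarrow> normal_residual m \<rho> C G0 G1 G2 c s = 0"
    and "m \<noteq> 0" "m \<noteq> -1"
    and y: "C + \<i> * \<rho> \<noteq> 0" and "\<rho>^2 + C^2 \<noteq> 1"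
  shows False
proof -
  define P where "P t = \<rho> + sin t" for t
  define Q where "Q t = C + cos t" for t
  define S where "S t = (P t)^2 + (Q t)^2" for t
  define j where "j t = sin t * P t + cos t * Q t" for t
  define x where "x t = S t * cos t + (G0 + G1 * cos t + G2 * sin t)" for t
  define h where "h t = x t + S t * Q t + cos t * j t" for t
  define k where "k t = Q t * x t - sin t * P t * j t" for t
  note defs = h_def k_def x_def j_def S_def P_def Q_def
  have eq: "m * (h t)^2 - (1 + m)^2 * S t * k t = 0" for t
    using id[of "cos t" "sin t"] by (simp add: normal_residual_def Let_def defs)
  \<comment> \<open>S = (Q + iP)(Q - iP), and the angle with e^(it) = z makes the first factor
    vanish.\<close>
  define z where "z = - (C + \<i> * \<rho>)"
  have nz: "z \<noteq> 0" using y unfolding z_def by (metis neg_equal_0_iff_equal)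
  define t where "t = - \<i> * Ln z"
  have ez: "exp (\<i> * t) = z" using nz by (simp add: t_def)
  have "z = cos t + \<i> * sin t" using ez by (simp add: exp_Euler)
  then have z: "cos t + \<i> * sin t = - (C + \<i> * \<rho>)" by (simp add: z_def)
  then have PQ: "P t = \<i> * Q t" unfolding P_def Q_def
    using i_squared by algebra
  have S0: "S t = 0" unfolding S_def PQ by (simp add: power_mult_distrib)
  have "h t = 0" using eq[of t] S0 \<open>m \<noteq> 0\<close> by simp
  have "h field_differentiable at t"
    unfolding defs by (intro derivative_intros field_differentiable_at_sin field_differentiable_at_cos)
  then obtain h' where h': "(h has_field_derivative h') (at t)"
    by (auto simp: field_differentiable_def)
  have "k field_differentiable at t"
    unfolding defs by (intro derivative_intros field_differentiable_at_sin field_differentiable_at_cos)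
  then obtain k' where k': "(k has_field_derivative k') (at t)"
    by (auto simp: field_differentiable_def)
  define S' where "S' = 2 * (\<rho> * cos t - C * sin t)"
  have S': "(S has_field_derivative S') (at t)"
    unfolding S_def P_def Q_def S'_def
    by (rule derivative_eq_intros refl | simp add: algebra_simps)+
  have "((\<lambda>t. m * (h t)^2 - (1 + m)^2 * S t * k t) has_field_derivative
      (m * (2 * h t * h') - (1 + m)^2 * (S' * k t + S t * k'))) (at t)"
    by (rule derivative_eq_intros h' k' S' refl | simp add: algebra_simps)+
  \<comment> \<open>As \<open>h\<close> and \<open>S\<close> vanish at \<open>t\<close>, only the
    term with S' k survives in the derivative of the identity.\<close>
  then have "((\<lambda>t. 0) has_field_derivative (- ((1 + m)^2 * (S' * k t)))) (at t)"
    using eq \<open>h t = 0\<close> S0 by simp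
  then have "(1 + m)^2 * (S' * k t) = 0"
    using DERIV_unique[OF _ DERIV_const] by fastforce
  moreover have "1 + m \<noteq> 0" using \<open>m \<noteq> -1\<close> by (simp add: add_eq_0_iff)
  ultimately have Sk: "S' = 0 \<or> k t = 0" by simp
  have cz: "cos t + \<i> * sin t = z" using z z_def by simp
  have jz: "j t = Q t * z" unfolding j_def PQ cz[symmetric] by (simp add: algebra_simps)
  have "S' = 2 * \<i> * (Q t * z)"
    using PQ cz i_squared unfolding S'_def P_def Q_def by algebra
  \<comment> \<open>Q = 0 forces P = 0, so (-C, -\<rho>) would lie on the circle; that is the
    excluded double zero.\<close>
  moreover have "Q t \<noteq> 0"
  proof
    assume Q0: "Q t = 0"
    then have "sin t = - \<rho>" "cos t = - C" using PQ by (simp_all add: P_def Q_def add_eq_0_iff2 minus_equation_iff)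
    with sin_cos_squared_add[of t] have "\<rho>^2 + C^2 = 1" by simp
    with assms(5) show False by simp
  qed
  ultimately have "k t = 0" using Sk nz by simp
  have "k t = - ((j t)^2)"
    using \<open>h t = 0\<close> S0 unfolding k_def h_def j_def by algebra
  with \<open>k t = 0\<close> jz nz \<open>Q t \<noteq> 0\<close> show False by simp
qed

text \<open>The zero of \<open>S = 2 j\<close> is now double and lies at a real angle; dividing the identity by
  \<open>j\<^sup>2\<close> leaves one that already fails at the points $(\pm\sqrt 2, \pm i)$.\<close>

lemma no_solution_double_root:
  fixes \<rho> C :: real and m G0 G1 G2 :: complex
  assumes id: "\<And>c s. c^2 + s^2 = 1 \<Longrightarrow> normal_residual m (of_real \<rho>) (of_real C) G0 G1 G2 c s = 0"
    and "m \<noteq> 0" and n: "25 * m = 6 * (1 + m)^2" and "\<rho>^2 + C^2 = 1"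
  shows False
proof -
  \<comment> \<open>(c0, s0) is the point of the circle where P = Q = 0.\<close>
  define s0 where "s0 = - complex_of_real \<rho>"
  define c0 where "c0 = - complex_of_real C"
  have "complex_of_real (\<rho>^2 + C^2) = 1" using assms(4) by simp
  then have cs0: "c0^2 + s0^2 = 1" by (simp add: s0_def c0_def add.commute)
  define j where "j c s = 1 - c0 * c - s0 * s" for c s
  define h where "h c s = G0 + G1 * c + G2 * s + j c s * (5 * c - 2 * c0)" for c s
  define k where "k c s = (c - c0) * (2 * j c s * c + (G0 + G1 * c + G2 * s)) - s * (s - s0) * j c s" for c s
  have eq: "6 * (h c s)^2 = 50 * j c s * k c s" if cs: "c^2 + s^2 = 1" for c s
  proof -
    have j1: "s * (s - s0) + c * (c - c0) = j c s" and S1: "(s - s0)^2 + (c - c0)^2 = 2 * j c s"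
      using cs cs0 unfolding j_def by algebra+
    have \<rho>C: "complex_of_real \<rho> + s = s - s0" "complex_of_real C + c = c - c0"
      by (simp_all add: s0_def c0_def)
    from id[OF cs] have "m * (2 * j c s * c + (G0 + G1 * c + G2 * s) + 2 * j c s * (c - c0) + c * j c s)^2
      - (1 + m)^2 * (2 * j c s) * k c s = 0"
      unfolding normal_residual_def Let_def \<rho>C j1 S1 k_def .
    then have "m * (6 * (h c s)^2 - 50 * j c s * k c s) = 0"
      using n unfolding h_def by algebra
    then show ?thesis using \<open>m \<noteq> 0\<close> by simp
  qed
  have j0: "j c0 s0 = 0" using cs0 by (simp add: j_def power2_eq_square algebra_simps)
  have h0: "h c0 s0 = 0" using eq[OF cs0] j0 by simp
  then have G0: "G0 = - (G1 * c0 + G2 * s0)" using j0 unfolding h_def by algebra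
  \<comment> \<open>Divide 6 h^2 = 50 j k by (t - t0)^2 and let t tend to t0: \<open>j\<close> has
    derivative 0 there and \<open>k\<close> vanishes, so the derivative of \<open>h\<close> is 0 as
    well.\<close>
  have "G2 * c0 - G1 * s0 = 0"
  proof -
    obtain t0 where t0: "cos t0 = c0" "sin t0 = s0" using complex_circle_param[OF cs0] .
    define J where "J t = j (cos t) (sin t)" for t
    define H where "H t = h (cos t) (sin t)" for t
    define K where "K t = k (cos t) (sin t)" for t
    have dJ: "(J has_field_derivative 0) (at t0)"
      unfolding J_def j_def by (rule derivative_eq_intros refl | simp add: t0)+
    have dH: "(H has_field_derivative (G2 * c0 - G1 * s0)) (at t0)"
      unfolding H_def h_def J_def[symmetric]
      by (rule derivative_eq_intros dJ refl | simp add: t0 J_def j0)+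
    have "K field_differentiable at t0"
      unfolding K_def k_def j_def by (intro derivative_intros field_differentiable_at_sin field_differentiable_at_cos)
    then obtain K' where dK: "(K has_field_derivative K') (at t0)"
      by (auto simp: field_differentiable_def)
    have z: "H t0 = 0" "J t0 = 0" "K t0 = 0"
      using h0 j0 G0 by (simp_all add: H_def J_def K_def k_def t0)
    have "((\<lambda>t. 6 * ((H t - H t0) / (t - t0))^2 - 50 * ((J t - J t0) / (t - t0)) * ((K t - K t0) / (t - t0)))
        \<longlongrightarrow> 6 * (G2 * c0 - G1 * s0)^2 - 50 * 0 * K') (at t0)"
      using dJ dH dK unfolding has_field_derivative_iff by (intro tendsto_intros)
    moreover have "(\<lambda>t. 6 * ((H t - H t0) / (t - t0))^2 - 50 * ((J t - J t0) / (t - t0)) * ((K t - K t0) / (t - t0)))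
        = (\<lambda>t. 0)"
    proof
      fix t
      have "6 * (H t)^2 = 50 * J t * K t" using eq[of "cos t" "sin t"] by (simp add: H_def J_def K_def)
      then show "6 * ((H t - H t0) / (t - t0))^2 - 50 * ((J t - J t0) / (t - t0)) * ((K t - K t0) / (t - t0)) = 0"
        unfolding z by (simp add: power_divide) (simp add: power2_eq_square)
    qed
    ultimately have "((\<lambda>t. 0) \<longlongrightarrow> 6 * (G2 * c0 - G1 * s0)^2 - 50 * 0 * K') (at t0)"
      by (simp only:)
    then have "6 * (G2 * c0 - G1 * s0)^2 - 50 * 0 * K' = 0"
      by (rule tendsto_unique[OF trivial_limit_at _ tendsto_const])
    then show ?thesis by simp
  qed
  \<comment> \<open>The affine function G0 + G1 c + G2 s now has a double zero at (c0, s0), so it is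
    a multiple X of \<open>j\<close>.\<close>
  define X where "X = - (G1 * c0 + G2 * s0)"
  have GX: "G0 = X" "G1 = - X * c0" "G2 = - X * s0"
    using G0 \<open>G2 * c0 - G1 * s0 = 0\<close> cs0 unfolding X_def by algebra+
  have red: "6 * (X + 5 * c - 2 * c0)^2 = 50 * ((c - c0) * (2 * c + X) - s * (s - s0))"
    if cs: "c^2 + s^2 = 1" and nz: "j c s \<noteq> 0" for c s
  proof -
    have G: "G0 + G1 * c + G2 * s = X * j c s" unfolding GX j_def by algebra
    have "(j c s)^2 * (6 * (X + 5 * c - 2 * c0)^2 - 50 * ((c - c0) * (2 * c + X) - s * (s - s0))) = 0"
      using eq[OF cs] unfolding h_def k_def G by algebra
    then show ?thesis using nz by simp
  qed
  \<comment> \<open>Changing the sign of \<open>s\<close> at these points isolates s0, changing that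
    of \<open>c\<close> isolates X - 2 c0. Once both vanish, a false numerical equation
    remains.\<close>
  define c where "c = complex_of_real (sqrt 2)"
  have c2: "c^2 = 2" by (simp add: c_def flip: of_real_power)
  have nz: "j (\<delta> * c) (\<eta> * \<i>) \<noteq> 0" if "\<delta> = 1 \<or> \<delta> = -1" "\<eta> = 1 \<or> \<eta> = -1" for \<delta> \<eta>
  proof
    assume 0: "j (\<delta> * c) (\<eta> * \<i>) = 0"
    have "Im (j (\<delta> * c) (\<eta> * \<i>)) = Re \<eta> * \<rho>" "Re (j (\<delta> * c) (\<eta> * \<i>)) = 1 + Re \<delta> * C * sqrt 2"
      using that by (auto simp: j_def c_def c0_def s0_def)
    with 0 that have r: "\<rho> = 0" "1 + Re \<delta> * C * sqrt 2 = 0" by auto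
    have "(Re \<delta> * C * sqrt 2)^2 = (-1)^2" using r(2) by (intro arg_cong[where f = "\<lambda>x. x^2"]) simp
    with that r(1) assms(4) show False by (auto simp: power_mult_distrib)
  qed
  have e1: "6 * (X + 5 * c - 2 * c0)^2 = 50 * ((c - c0) * (2 * c + X) - \<i> * (\<i> - s0))"
    using red[of c \<i>] nz[of 1 1] c2 by simp
  have e2: "6 * (X + 5 * c - 2 * c0)^2 = 50 * ((c - c0) * (2 * c + X) - (-\<i>) * (-\<i> - s0))"
    using red[of c "-\<i>"] nz[of 1 "-1"] c2 by simp
  have e3: "6 * (X + 5 * (-c) - 2 * c0)^2 = 50 * ((-c - c0) * (2 * (-c) + X) - \<i> * (\<i> - s0))"
    using red[of "-c" \<i>] nz[of "-1" 1] c2 by simp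
  have "\<i> * s0 = 0" using e1 e2 by algebra
  then have s0: "s0 = 0" by simp
  have c01: "c0^2 = 1" using cs0 s0 by simp
  have "c * (X - 2 * c0) = 0" using e1 e3 by algebra
  moreover have "c \<noteq> 0" using c2 by auto
  ultimately have X: "X = 2 * c0" by simp
  have "(150::complex) = 75" using e1 c2 c01 i_squared unfolding X s0 by algebra
  then show False by simp
qed

text \<open>The cases follow the zeros of \<open>S\<close>: it is constant when (\<rho>, C) is the
  origin, has a double zero when (\<rho>, C) is on the unit circle, and a simple zero
  otherwise.\<close>

lemma no_solution_critical:
  fixes m \<rho> C G0 G1 G2 :: real
  assumes id: "\<And>c s::complex. c^2 + s^2 = 1 \<Longrightarrow>
    normal_residual (of_real m) (of_real \<rho>) (of_real C) (of_real G0) (of_real G1) (of_real G2) c s = 0"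
    and "m \<noteq> 0" and n: "25 * m = 6 * (1 + m)^2"
  shows False
proof (cases "\<rho> = 0 \<and> C = 0")
  case True
  then show ?thesis using no_solution_centred[of m G0 G1 G2, OF _ assms(2,3)] id by simp
next
  case False
  then have y: "complex_of_real C + \<i> * \<rho> \<noteq> 0" by (auto simp: complex_eq_iff)
  \<comment> \<open>m = -1 would turn the critical relation into -25 = 0.\<close>
  have m1: "complex_of_real m \<noteq> 0" "complex_of_real m \<noteq> -1"
    using assms(2,3) by (auto simp: complex_eq_iff)
  have "complex_of_real (25 * m) = of_real (6 * (1 + m)^2)" using n by simp
  then have n': "25 * complex_of_real m = 6 * (1 + of_real m)^2" by simp
  show ?thesis
  proof (cases "\<rho>^2 + C^2 = 1")
    case True
    then show ?thesis using no_solution_double_root[OF id m1(1) n'] by blast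
  next
    case False
    then have "(complex_of_real \<rho>)^2 + (of_real C)^2 \<noteq> 1"
      by (metis of_real_add of_real_power of_real_eq_1_iff)
    then show ?thesis using no_solution_simple_root[OF id m1 y] by blast
  qed
qed

section \<open>Curvatures in a moving frame\<close>

text \<open>Componentwise, to match \<open>smooth_curve_on\<close>.\<close>

definition vec_deriv :: "(real \<Rightarrow> real^3) \<Rightarrow> real \<Rightarrow> real^3" where
  "vec_deriv f s = (\<chi> i. deriv (\<lambda>x. f x $ i) s)"

lemma has_vector_derivative_vec_nth:
  fixes f :: "real \<Rightarrow> real^'n"
  assumes "\<And>i. ((\<lambda>x. f x $ i) has_real_derivative v $ i) (at s)"
  shows "(f has_vector_derivative v) (at s)"
  unfolding has_vector_derivative_def
proof (rule has_derivative_componentwise_within[THEN iffD2], rule ballI)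
  fix b :: "real^'n" assume "b \<in> Basis"
  then obtain i where b: "b = axis i 1" by (auto simp: Basis_vec_def)
  have "(\<lambda>x. f x \<bullet> b) = (\<lambda>x. f x $ i)" "(\<lambda>h. (h *\<^sub>R v) \<bullet> b) = (*) (v $ i)"
    by (auto simp: b inner_axis fun_eq_iff)
  then show "((\<lambda>x. f x \<bullet> b) has_derivative (\<lambda>h. (h *\<^sub>R v) \<bullet> b)) (at s)"
    using assms[of i] by (simp only: has_field_derivative_def)
qed

lemma smooth_curve_derivative:
  assumes "smooth_curve_on U f" "s \<in> U"
  shows "(f has_vector_derivative vec_deriv f s) (at s)"
    and "(vec_deriv f has_vector_derivative vec_deriv (vec_deriv f) s) (at s)"
proof -
  have *: "((deriv ^^ k) (\<lambda>x. f x $ i)) differentiable (at s)" for k i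
    using assms by (auto simp: smooth_curve_on_def smooth_real_on_def)
  show "(f has_vector_derivative vec_deriv f s) (at s)"
    using *[of 0] by (intro has_vector_derivative_vec_nth)
      (auto simp: vec_deriv_def DERIV_deriv_iff_real_differentiable)
  show "(vec_deriv f has_vector_derivative vec_deriv (vec_deriv f) s) (at s)"
    using *[of 1] by (intro has_vector_derivative_vec_nth)
      (auto simp: vec_deriv_def DERIV_deriv_iff_real_differentiable)
qed

lemma smooth_real_derivative:
  assumes "smooth_real_on U f" "s \<in> U"
  shows "(f has_real_derivative deriv f s) (at s)"
    and "(deriv f has_real_derivative deriv (deriv f) s) (at s)"
proof -
  have *: "((deriv ^^ k) f) differentiable (at s)" for k
    using assms by (auto simp: smooth_real_on_def)
  show "(f has_real_derivative deriv f s) (at s)" "(deriv f has_real_derivative deriv (deriv f) s) (at s)"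
    using *[of 0] *[of 1] by (auto simp: DERIV_deriv_iff_real_differentiable)
qed

text \<open>The relation reads (1 + m) sqrt(H^2 - K) = (m - 1) H; squaring gives 4mH^2 = (1 + m)^2
  K. The unnormalised normal has squared length EG - F^2, so clearing denominators leaves a
  polynomial equation.\<close>

lemma weingarten_quadratic:
  assumes kap: "kappa1 X s t = m * kappa2 X s t"
    and reg: "cross3 (Xs X s t) (Xt X s t) \<noteq> 0"
    and l: "l = cross3 (Xs X s t) (Xt X s t) \<bullet> Xss X s t"
    and f: "f = cross3 (Xs X s t) (Xt X s t) \<bullet> Xst X s t"
    and g: "g = cross3 (Xs X s t) (Xt X s t) \<bullet> Xtt X s t"
    and E: "E = Xs X s t \<bullet> Xs X s t" and F: "F = Xs X s t \<bullet> Xt X s t" and G: "G = Xt X s t \<bullet> Xt X s t"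
  shows "m * (l * G - 2 * f * F + g * E)^2 = (1 + m)^2 * (E * G - F^2) * (l * g - f^2)"
proof -
  define n where "n = norm (cross3 (Xs X s t) (Xt X s t))"
  define W where "W = E * G - F^2"
  define T where "T = l * G - 2 * f * F + g * E"
  have n0: "n > 0" using reg by (simp add: n_def)
  have nW: "n^2 = W"
    unfolding n_def W_def E F G
    using norm_cross_dot[of "Xs X s t" "Xt X s t"] by (simp add: power2_norm_eq_inner power_mult_distrib)
  have W0: "W > 0" using n0 nW by (metis zero_less_power)
  then have "G \<noteq> 0" unfolding W_def using zero_le_power2[of F] by auto
  have fe: "fe X s t = l / n" "ff X s t = f / n" "fg X s t = g / n"
    by (simp_all add: fe_def ff_def fg_def unit_normal_def l f g n_def)
  have H: "mean_curv X s t = T / (n * (2 * W))"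
    unfolding mean_curv_def fe fE_def fF_def fG_def E[symmetric] F[symmetric] G[symmetric] W_def[symmetric] T_def
    using n0 W0 by (simp add: field_simps)
  have "gauss_curv X s t = (l * g - f^2) / (n^2 * W)"
    unfolding gauss_curv_def fe fE_def fF_def fG_def E[symmetric] F[symmetric] G[symmetric] W_def[symmetric]
    using n0 W0 by (simp add: field_simps power2_eq_square)
  then have K: "gauss_curv X s t = (l * g - f^2) / W^2"
    unfolding nW by (simp add: power2_eq_square)
  have H2: "(mean_curv X s t)^2 = T^2 / (4 * W^3)"
    unfolding H power_divide power_mult_distrib nW by (simp add: power2_eq_square power3_eq_cube)
  define d where "d = (mean_curv X s t)^2 - gauss_curv X s t"
  \<comment> \<open>Squaring the root requires H^2 - K \<ge> 0, since \<open>sqrt\<close> of a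
    negative number squares to its absolute value. Here \<open>G^2\<close> times the discriminant is
    a square plus 4W times a square.\<close>
  have "G^2 * (T^2 - 4 * W * (l * g - f^2)) = (G * (l * G - g * E) - 2 * F * (f * G - g * F))^2 + 4 * W * (f * G - g * F)^2"
    unfolding T_def W_def by algebra
  then have "G^2 * (T^2 - 4 * W * (l * g - f^2)) \<ge> 0" using W0 by simp
  then have "T^2 - 4 * W * (l * g - f^2) \<ge> 0" using \<open>G \<noteq> 0\<close> by (simp add: zero_le_mult_iff)
  moreover have d4: "d = (T^2 - 4 * W * (l * g - f^2)) / (4 * W^3)"
    unfolding d_def H2 K using W0 by (simp add: field_simps power2_eq_square power3_eq_cube)
  ultimately have "d \<ge> 0" using W0 by simp
  then have sq: "(sqrt d)^2 = d" by simp
  have "(1 + m) * sqrt d = (m - 1) * mean_curv X s t"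
    using kap unfolding kappa1_def kappa2_def d_def[symmetric] by (simp add: algebra_simps)
  then have "(1 + m)^2 * d = (m - 1)^2 * (mean_curv X s t)^2"
    using sq by algebra
  then have "4 * m * (mean_curv X s t)^2 = (1 + m)^2 * gauss_curv X s t"
    unfolding d_def by algebra
  then have "4 * m * (T^2 / (4 * W^3)) = (1 + m)^2 * ((l * g - f^2) / W^2)"
    unfolding H2 K .
  then have "m * T^2 = (1 + m)^2 * W * (l * g - f^2)"
    using W0 by (simp add: field_simps power2_eq_square power3_eq_cube)
  then show ?thesis by (simp add: T_def W_def)
qed

section \<open>Coordinates in the frame of a circle\<close>

locale orthonormal_pair =
  fixes e1 e2 :: "real^3"
  assumes unit: "e1 \<bullet> e1 = 1" "e2 \<bullet> e2 = 1" and orth: "e1 \<bullet> e2 = 0"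
begin

definition N where "N = cross3 e1 e2"

definition fr where "fr x y z = x *\<^sub>R e1 + y *\<^sub>R e2 + z *\<^sub>R N"

lemma inner_table: "e1 \<bullet> N = 0" "e2 \<bullet> N = 0" "N \<bullet> e1 = 0" "N \<bullet> e2 = 0" "e2 \<bullet> e1 = 0" "N \<bullet> N = 1"
proof -
  show "e1 \<bullet> N = 0" "e2 \<bullet> N = 0" "N \<bullet> e1 = 0" "N \<bullet> e2 = 0"
    by (simp_all add: N_def dot_cross_self)
  show "e2 \<bullet> e1 = 0" using orth by (simp add: inner_commute)
  show "N \<bullet> N = 1"
    using norm_cross_dot[of e1 e2] unit orth by (simp add: N_def power2_norm_eq_inner power_mult_distrib)
qed

lemma cross_table:
  "cross3 e1 e2 = N" "cross3 e2 e1 = - N" "cross3 N e1 = e2" "cross3 e1 N = - e2"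
  "cross3 e2 N = e1" "cross3 N e2 = - e1"
proof -
  show *: "cross3 e1 N = - e2" "cross3 e2 N = e1"
    by (simp_all add: N_def Lagrange unit orth inner_commute[of e2 e1])
  show "cross3 N e1 = e2" "cross3 N e2 = - e1"
    using * cross_skew[of N e1] cross_skew[of N e2] by simp_all
  show "cross3 e1 e2 = N" "cross3 e2 e1 = - N"
    using cross_skew[of e2 e1] by (simp_all add: N_def)
qed

lemma expand: "v = fr (v \<bullet> e1) (v \<bullet> e2) (v \<bullet> N)"
proof -
  define w where "w = v - fr (v \<bullet> e1) (v \<bullet> e2) (v \<bullet> N)"
  have w: "w \<bullet> e1 = 0" "w \<bullet> e2 = 0" "w \<bullet> N = 0"
    by (simp_all add: w_def fr_def inner_diff_left inner_add_left unit orth inner_table)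
  \<comment> \<open>Lagrange's formula writes w x (e1 x e2) through w . e1 and w . e2 only.\<close>
  have "cross3 w N = 0" by (simp add: N_def Lagrange w)
  with w(3) have "w = 0 \<or> N = 0" using norm_and_cross_eq_0 by blast
  moreover have "N \<noteq> 0" using inner_table by auto
  ultimately show ?thesis by (simp add: w_def)
qed

lemma inner_fr: "fr x y z \<bullet> fr x' y' z' = x * x' + y * y' + z * z'"
  by (simp add: fr_def inner_add_left inner_add_right unit orth inner_table)

lemma cross_fr: "cross3 (fr x y z) (fr x' y' z') = fr (y * z' - z * y') (z * x' - x * z') (x * y' - y * x')"
  by (simp add: fr_def cross_add_left cross_add_right cross_mult_left cross_mult_right cross_table
      algebra_simps)

lemma add_fr: "fr x y z + fr x' y' z' = fr (x + x') (y + y') (z + z')"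
  and frame_fr: "e1 = fr 1 0 0" "e2 = fr 0 1 0"
  by (simp_all add: fr_def algebra_simps)

end

context orthonormal_pair
begin

text \<open>\<open>x\<close>, \<open>y\<close>, \<open>xx\<close>, \<open>xy\<close>,
  \<open>yy\<close> are the partial derivatives of the parametrisation at one point; the conditions
  \<open>d\<close> and \<open>dd\<close> are orthonormality differentiated once and twice. Passing
  to the basis x - \<omega>y, y has determinant 1 and preserves both curvature numerators, so
  \<omega> cancels.\<close>

lemma circle_residual:
  fixes d1 d2 c1 c2 dd1 dd2 :: "real^3" and m r r1 r2 t :: real
  defines "\<omega> \<equiv> d1 \<bullet> e2" and "p \<equiv> d1 \<bullet> N" and "q \<equiv> d2 \<bullet> N"
    and "A \<equiv> c1 \<bullet> e1" and "B \<equiv> c1 \<bullet> e2" and "C \<equiv> c1 \<bullet> N"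
  defines "x \<equiv> c1 + r1 *\<^sub>R (cos t *\<^sub>R e1 + sin t *\<^sub>R e2) + r *\<^sub>R (cos t *\<^sub>R d1 + sin t *\<^sub>R d2)"
    and "y \<equiv> r *\<^sub>R (- sin t *\<^sub>R e1 + cos t *\<^sub>R e2)"
    and "xx \<equiv> c2 + r2 *\<^sub>R (cos t *\<^sub>R e1 + sin t *\<^sub>R e2) + (2 * r1) *\<^sub>R (cos t *\<^sub>R d1 + sin t *\<^sub>R d2)
            + r *\<^sub>R (cos t *\<^sub>R dd1 + sin t *\<^sub>R dd2)"
    and "xy \<equiv> r1 *\<^sub>R (- sin t *\<^sub>R e1 + cos t *\<^sub>R e2) + r *\<^sub>R (- sin t *\<^sub>R d1 + cos t *\<^sub>R d2)"
    and "yy \<equiv> - r *\<^sub>R (cos t *\<^sub>R e1 + sin t *\<^sub>R e2)"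
  defines "l \<equiv> cross3 x y \<bullet> xx" and "f \<equiv> cross3 x y \<bullet> xy" and "g \<equiv> cross3 x y \<bullet> yy"
  assumes d: "d1 \<bullet> e1 = 0" "d2 \<bullet> e2 = 0" "d2 \<bullet> e1 = - \<omega>"
    and dd: "dd1 \<bullet> e1 = - (d1 \<bullet> d1)" "dd2 \<bullet> e2 = - (d2 \<bullet> d2)" "dd1 \<bullet> e2 + dd2 \<bullet> e1 = - 2 * (d1 \<bullet> d2)"
    and eq: "m * (l * (y \<bullet> y) - 2 * f * (x \<bullet> y) + g * (x \<bullet> x))^2
      = (1 + m)^2 * ((x \<bullet> x) * (y \<bullet> y) - (x \<bullet> y)^2) * (l * g - f^2)"
    and "r \<noteq> 0"
  shows "weingarten_residual m r r1 r2 p q (dd1 \<bullet> N - 2 * \<omega> * q) (dd2 \<bullet> N + 2 * \<omega> * p)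
    A B (c2 \<bullet> e1 + p * C) (c2 \<bullet> e2 + q * C) C (c2 \<bullet> N - p * A - q * B) (cos t) (sin t) = 0"
proof -
  define c s where "c = cos t" and "s = sin t"
  have cs: "c^2 + s^2 = 1" by (simp add: c_def s_def)
  define \<gamma>1 \<gamma>2 \<gamma>3 where "\<gamma>1 = c2 \<bullet> e1" and "\<gamma>2 = c2 \<bullet> e2" and "\<gamma>3 = c2 \<bullet> N"
  \<comment> \<open>Orthonormality leaves \<open>\<eta>\<close> undetermined; it cancels on
    contraction with the surface normal.\<close>
  define \<eta> n1 n2 where "\<eta> = dd1 \<bullet> e2" and "n1 = dd1 \<bullet> N" and "n2 = dd2 \<bullet> N"
  have d1: "d1 = fr 0 \<omega> p" using expand[of d1] d by (simp add: \<omega>_def p_def)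
  have d2: "d2 = fr (- \<omega>) 0 q" using expand[of d2] d by (simp add: q_def)
  have c1: "c1 = fr A B C" using expand[of c1] by (simp add: A_def B_def C_def)
  have c2: "c2 = fr \<gamma>1 \<gamma>2 \<gamma>3" using expand[of c2] by (simp add: \<gamma>1_def \<gamma>2_def \<gamma>3_def)
  have dd1: "dd1 = fr (- (\<omega>^2 + p^2)) \<eta> n1"
    using expand[of dd1] dd(1) by (simp add: d1 inner_fr \<eta>_def n1_def power2_eq_square)
  have "dd2 \<bullet> e1 = - 2 * (p * q) - \<eta>" using dd(3) by (simp add: d1 d2 inner_fr \<eta>_def)
  then have dd2: "dd2 = fr (- 2 * (p * q) - \<eta>) (- (\<omega>^2 + q^2)) n2"
    using expand[of dd2] dd(2) by (simp add: d2 inner_fr n2_def power2_eq_square)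
  define \<kappa> \<mu> b P Q where "\<kappa> = p * c + q * s" and "\<mu> = q * c - p * s" and "b = B * c - A * s"
    and "P = r1 + A * c + B * s" and "Q = C + r * \<kappa>"
  define g' where "g' = P * ((\<gamma>3 - p * A - q * B) + r1 * \<kappa> + r * ((n1 - 2 * \<omega> * q) * c + (n2 + 2 * \<omega> * p) * s))
    - Q * (r2 + (\<gamma>1 + p * C) * c + (\<gamma>2 + q * C) * s)"
  have x: "x = fr (A + r1 * c - r * \<omega> * s) (B + r1 * s + r * \<omega> * c) Q"
    unfolding x_def c1 d1 d2 c_def[symmetric] s_def[symmetric] fr_def Q_def \<kappa>_def
    by (simp add: algebra_simps)
  have y: "y = fr (- r * s) (r * c) 0"
    unfolding y_def c_def[symmetric] s_def[symmetric] fr_def by (simp add: algebra_simps)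
  have xx: "xx = fr (\<gamma>1 + r2 * c - 2 * r1 * \<omega> * s + r * (- (\<omega>^2 + p^2) * c + (- 2 * (p * q) - \<eta>) * s))
     (\<gamma>2 + r2 * s + 2 * r1 * \<omega> * c + r * (\<eta> * c - (\<omega>^2 + q^2) * s))
     (\<gamma>3 + 2 * r1 * \<kappa> + r * (n1 * c + n2 * s))"
    unfolding xx_def c2 d1 d2 dd1 dd2 c_def[symmetric] s_def[symmetric] fr_def \<kappa>_def
    by (simp add: algebra_simps)
  have xy: "xy = fr (- r1 * s - r * \<omega> * c) (r1 * c - r * \<omega> * s) (r * \<mu>)"
    unfolding xy_def d1 d2 c_def[symmetric] s_def[symmetric] fr_def \<mu>_def
    by (simp add: algebra_simps)
  have yy: "yy = fr (- r * c) (- r * s) 0"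
    unfolding yy_def c_def[symmetric] s_def[symmetric] fr_def by (simp add: algebra_simps)
  have V: "cross3 x y = fr (- r * Q * c) (- r * Q * s) (r * P)"
    unfolding x y cross_fr
  proof -
    have "(A + r1 * c - r * \<omega> * s) * (r * c) - (B + r1 * s + r * \<omega> * c) * (- r * s) = r * P"
      using cs unfolding P_def by algebra
    then show "fr ((B + r1 * s + r * \<omega> * c) * 0 - Q * (r * c)) (Q * (- r * s) - (A + r1 * c - r * \<omega> * s) * 0)
     ((A + r1 * c - r * \<omega> * s) * (r * c) - (B + r1 * s + r * \<omega> * c) * (- r * s))
      = fr (- r * Q * c) (- r * Q * s) (r * P)" by (simp add: mult.commute mult.left_commute)
  qed
  define S where "S = P^2 + Q^2"
  define v where "v = b + r * \<omega>"
  have G: "y \<bullet> y = r^2" unfolding y inner_fr using cs by algebra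
  have F: "x \<bullet> y = r * v" unfolding x y inner_fr v_def b_def using cs by algebra
  have E: "x \<bullet> x = S + v^2" unfolding x inner_fr S_def v_def b_def P_def using cs by algebra
  have g: "g = r * (r * Q)" unfolding g_def V yy inner_fr using cs by algebra
  have f: "f = r * (r * \<mu> * P + r * \<omega> * Q)" unfolding f_def V xy inner_fr using cs by algebra
  \<comment> \<open>\<open>L\<close>, \<open>r * \<mu> * P\<close> and \<open>r * Q\<close> are, up
    to a factor \<open>r\<close>, the second fundamental form in the basis x - \<omega>y, y.\<close>
  define L where "L = S * \<kappa> + b * \<mu> * P + g'"
  have l: "l = r * (L + 2 * \<omega> * (r * \<mu> * P) + \<omega>^2 * (r * Q))"
  proof -
    have n: "\<gamma>3 + 2 * r1 * \<kappa> + r * (n1 * c + n2 * s)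
      = ((\<gamma>3 - p * A - q * B) + r1 * \<kappa> + r * ((n1 - 2 * \<omega> * q) * c + (n2 + 2 * \<omega> * p) * s))
        + \<kappa> * P + \<mu> * b + 2 * r * \<omega> * \<mu>"
      using cs unfolding \<kappa>_def \<mu>_def b_def P_def by algebra
    have u: "c * (\<gamma>1 + r2 * c - 2 * r1 * \<omega> * s + r * (- (\<omega>^2 + p^2) * c + (- 2 * (p * q) - \<eta>) * s))
      + s * (\<gamma>2 + r2 * s + 2 * r1 * \<omega> * c + r * (\<eta> * c - (\<omega>^2 + q^2) * s))
      = (r2 + (\<gamma>1 + p * C) * c + (\<gamma>2 + q * C) * s) - \<kappa> * Q - r * \<omega>^2"
      using cs unfolding \<kappa>_def Q_def by algebra
    have "l = r * (P * (\<gamma>3 + 2 * r1 * \<kappa> + r * (n1 * c + n2 * s))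
       - Q * (c * (\<gamma>1 + r2 * c - 2 * r1 * \<omega> * s + r * (- (\<omega>^2 + p^2) * c + (- 2 * (p * q) - \<eta>) * s))
      + s * (\<gamma>2 + r2 * s + 2 * r1 * \<omega> * c + r * (\<eta> * c - (\<omega>^2 + q^2) * s))))"
      unfolding l_def V xx inner_fr by (simp add: algebra_simps)
    also have "\<dots> = r * (L + 2 * \<omega> * (r * \<mu> * P) + \<omega>^2 * (r * Q))"
      unfolding n u L_def g'_def S_def by (simp add: algebra_simps power2_eq_square)
    finally show ?thesis .
  qed
  have T: "l * (y \<bullet> y) - 2 * f * (x \<bullet> y) + g * (x \<bullet> x) = r^2 * mean_poly r \<kappa> \<mu> b P Q g'"
    unfolding l f g E F G mean_poly_def L_def v_def S_def by algebra
  have D: "l * g - f^2 = r^3 * gauss_poly r \<kappa> \<mu> b P Q g'"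
    unfolding l f g gauss_poly_def L_def S_def by algebra
  have W: "(x \<bullet> x) * (y \<bullet> y) - (x \<bullet> y)^2 = r^2 * S"
    unfolding E F G by algebra
  have "r^4 * (m * (mean_poly r \<kappa> \<mu> b P Q g')^2 - (1 + m)^2 * r * S * gauss_poly r \<kappa> \<mu> b P Q g') = 0"
    using eq unfolding T D W by algebra
  then have "m * (mean_poly r \<kappa> \<mu> b P Q g')^2 - (1 + m)^2 * r * S * gauss_poly r \<kappa> \<mu> b P Q g' = 0"
    using \<open>r \<noteq> 0\<close> by simp
  then show ?thesis
    unfolding weingarten_residual_def Let_def c_def[symmetric] s_def[symmetric]
      \<kappa>_def[symmetric] \<mu>_def[symmetric] b_def[symmetric] P_def[symmetric] Q_def[symmetric]
      \<gamma>1_def[symmetric] \<gamma>2_def[symmetric] \<gamma>3_def[symmetric] n1_def[symmetric] n2_def[symmetric]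
      g'_def[symmetric] S_def[symmetric] .
qed

end

section \<open>Rigidity of the planes\<close>

text \<open>The critical value of \<open>m\<close> is impossible, so the leading coefficient forces
  C + i r1 = 0 with both real. If also r2 = C1 = 0, then G1 = G2 = 0 and the constant case applies.
  The final alternative is refuted later, when r1 = C = 0 holds on a neighbourhood.\<close>

lemma rigidity:
  fixes m r r1 r2 p q p1 q1 A B A1 B1 C C1 \<epsilon> \<alpha> \<beta> :: real
  assumes "m \<noteq> 0" "r > 0" "p^2 + q^2 \<noteq> 0" "\<alpha> < \<beta>"
    and zero: "\<And>t. t \<in> {\<alpha><..<\<beta>} \<Longrightarrow>
      weingarten_residual m r r1 r2 p q p1 q1 A B A1 B1 C C1 (cos t) (sin t) = 0"
    and e: "\<epsilon>^2 = 1"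
    and A: "A = \<epsilon> * r * q" and B: "B = - \<epsilon> * r * p"
    and A1: "A1 = \<epsilon> * (r1 * q + r * q1)" and B1: "B1 = - \<epsilon> * (r1 * p + r * p1)"
  shows "r1 = 0" "C = 0" "r2 \<noteq> 0 \<or> C1 \<noteq> 0"
proof -
  define \<omega> where "\<omega> = sqrt (p^2 + q^2)"
  have w: "\<omega>^2 = p^2 + q^2" by (simp add: \<omega>_def)
  then have w0: "\<omega> \<noteq> 0" using assms(3) by auto
  define R where "R = r * \<omega>"
  have R0: "R \<noteq> 0" using \<open>r > 0\<close> w0 by (simp add: R_def)
  define l k where "l = (p * p1 + q * q1) / \<omega>" and "k = (q * p1 - p * q1) / \<omega>"
  define G0 where "G0 = r * (r1 * C1 - C * r2 + \<epsilon> * r^2 * \<omega> * k) / R^3"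
  define G1 where "G1 = r * (r1^2 * \<omega> + r1 * r * l + \<epsilon> * C * r * k - r * \<omega> * r2) / R^3"
  define G2 where "G2 = r * (\<epsilon> * r1 * r * k + r * \<omega> * C1 - C * r1 * \<omega> - C * r * l) / R^3"
  let ?z = "of_real :: real \<Rightarrow> complex"
  have nr: "normal_residual (?z m) (?z (r1 / R)) (?z (C / R)) (?z G0) (?z G1) (?z G2) c s = 0"
    if cs: "c^2 + s^2 = 1" for c s
  proof -
    have "normal_residual (?z m) (?z r1 / ?z R) (?z C / ?z R)
      (?z r * (?z r1 * ?z C1 - ?z C * ?z r2 + ?z \<epsilon> * ?z r^2 * ?z \<omega> * ?z k) / ?z R^3)
      (?z r * (?z r1^2 * ?z \<omega> + ?z r1 * ?z r * ?z l + ?z \<epsilon> * ?z C * ?z r * ?z k - ?z r * ?z \<omega> * ?z r2) / ?z R^3)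
      (?z r * (?z \<epsilon> * ?z r1 * ?z r * ?z k + ?z r * ?z \<omega> * ?z C1 - ?z C * ?z r1 * ?z \<omega> - ?z C * ?z r * ?z l) / ?z R^3) c s = 0"
    proof (rule normal_form[OF residual_extends[OF \<open>\<alpha> < \<beta>\<close> _ zero] _ _ _ _ _ _ _ _ _ _ _ cs])
      show "(?z \<epsilon>)^2 = 1" "(?z \<omega>)^2 = (?z p)^2 + (?z q)^2"
        using e w by (simp_all flip: of_real_power of_real_add)
    qed (use assms w0 in \<open>simp_all add: R_def l_def k_def A B A1 B1\<close>)
    then show ?thesis by (simp add: G0_def G1_def G2_def)
  qed
  have crit: "25 * m \<noteq> 6 * (1 + m)^2"
    using no_solution_critical[OF nr \<open>m \<noteq> 0\<close>] by blast
  have "25 * ?z m - 6 * (1 + ?z m)^2 = ?z (25 * m - 6 * (1 + m)^2)" by simp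
  also have "\<dots> \<noteq> 0"
    using crit by (subst of_real_eq_0_iff) simp
  finally have K: "25 * ?z m - 6 * (1 + ?z m)^2 \<noteq> 0" .
  have "?z (C / R) + \<i> * ?z (r1 / R) = 0"
    using normal_leading_coefficient[OF nr] K by (simp only: mult_eq_0_iff power_eq_0_iff) blast
  then show r1: "r1 = 0" and C: "C = 0" using R0 by (simp_all add: complex_eq_iff)
  show "r2 \<noteq> 0 \<or> C1 \<noteq> 0"
  proof (rule ccontr)
    assume "\<not> (r2 \<noteq> 0 \<or> C1 \<noteq> 0)"
    then have "G1 = 0" "G2 = 0" using r1 C by (simp_all add: G1_def G2_def)
    with nr r1 C have "normal_residual (?z m) 0 0 (?z G0) 0 0 c s = 0" if "c^2 + s^2 = 1" for c s
      using that by simp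
    then show False
      using no_solution_constant[of "?z m" "?z G0"] \<open>m \<noteq> 0\<close> by simp
  qed
qed

text \<open>With a = A + iB and \<pi> = p + iq, the last two assumptions are, up to factors, the
  real and imaginary parts of the derivative of a^2 + r^2 \<pi>^2 = 0. This squared relation spares
  a proof that the sign \<open>\<epsilon>\<close> is locally constant; as a \<noteq> 0, it
  determines a'.\<close>

lemma tangency_derivative:
  fixes A B p q r A' B' p' q' r' :: real
  assumes A: "A = \<epsilon> * r * q" and B: "B = - \<epsilon> * r * p" and e: "\<epsilon>^2 = 1"
    and "r \<noteq> 0" "p^2 + q^2 \<noteq> 0"
    and 1: "A * A' - B * B' + r * r' * (p^2 - q^2) + r^2 * (p * p' - q * q') = 0"
    and 2: "A' * B + A * B' + 2 * r * r' * p * q + r^2 * (p' * q + p * q') = 0"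
  shows "A' = \<epsilon> * (r' * q + r * q')" "B' = - \<epsilon> * (r' * p + r * p')"
proof -
  have "r * (p^2 + q^2) * (A' - \<epsilon> * (r' * q + r * q')) = 0"
    "r * (p^2 + q^2) * (B' + \<epsilon> * (r' * p + r * p')) = 0"
    using 1 2 e unfolding A B by algebra+
  then have "A' - \<epsilon> * (r' * q + r * q') = 0" "B' + \<epsilon> * (r' * p + r * p') = 0"
    using assms(4,5) by (auto simp only: mult_eq_0_iff)
  then show "A' = \<epsilon> * (r' * q + r * q')" "B' = - \<epsilon> * (r' * p + r * p')"
    by simp_all
qed

lemma derivative_zero_if_eventually:
  fixes f :: "real \<Rightarrow> real"
  assumes "(f has_real_derivative f') (at x)" "\<forall>\<^sub>F y in nhds x. f y = k"
  shows "f' = 0"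
proof -
  have "((\<lambda>_. k) has_real_derivative f') (at x)"
    using assms DERIV_cong_ev[OF refl assms(2) refl] by simp
  then show ?thesis using DERIV_unique DERIV_const by blast
qed

lemma has_real_derivative_inner:
  assumes "(f has_vector_derivative f') (at x)" "(g has_vector_derivative g') (at x)"
  shows "((\<lambda>x. f x \<bullet> g x) has_real_derivative f x \<bullet> g' + f' \<bullet> g x) (at x)"
  using bounded_bilinear.has_vector_derivative[OF bounded_bilinear_inner assms]
  by (simp add: has_real_derivative_iff_has_vector_derivative)

lemma has_vector_derivative_cross3:
  assumes "(f has_vector_derivative f') (at x)" "(g has_vector_derivative g') (at x)"
  shows "((\<lambda>x. cross3 (f x) (g x)) has_vector_derivative cross3 (f x) g' + cross3 f' (g x)) (at x)"
  by (rule bounded_bilinear.has_vector_derivative[OF _ assms])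
    (simp add: bilinear_conv_bounded_bilinear[symmetric] bilinear_cross)

lemma circle_derivative:
  assumes "(c has_vector_derivative c') (at s)" "(r has_real_derivative r') (at s)"
    "(e1 has_vector_derivative d1) (at s)" "(e2 has_vector_derivative d2) (at s)"
  shows "((\<lambda>u. c u + r u *\<^sub>R (x *\<^sub>R e1 u + y *\<^sub>R e2 u)) has_vector_derivative
    c' + r' *\<^sub>R (x *\<^sub>R e1 s + y *\<^sub>R e2 s) + r s *\<^sub>R (x *\<^sub>R d1 + y *\<^sub>R d2)) (at s)"
proof -
  have "((\<lambda>u. x *\<^sub>R e1 u + y *\<^sub>R e2 u) has_vector_derivative x *\<^sub>R d1 + y *\<^sub>R d2) (at s)"
    by (intro has_vector_derivative_add bounded_linear.has_vector_derivative[OF bounded_linear_scaleR_right] assms)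
  from has_vector_derivative_add[OF assms(1) has_vector_derivative_scaleR[OF assms(2) this]]
  show ?thesis by (simp add: add_ac)
qed

lemma angle_derivative:
  "((\<lambda>u. v + k *\<^sub>R (cos u *\<^sub>R f + sin u *\<^sub>R g) + k' *\<^sub>R (cos u *\<^sub>R f' + sin u *\<^sub>R g')) has_vector_derivative
    k *\<^sub>R (- sin t *\<^sub>R f + cos t *\<^sub>R g) + k' *\<^sub>R (- sin t *\<^sub>R f' + cos t *\<^sub>R g')) (at t)"
  by (auto intro!: derivative_eq_intros simp: algebra_simps)

section \<open>The family of circles and the constancy of its normal\<close>

locale cyclic_weingarten =
  fixes m a b \<alpha> \<beta> :: real
    and c e1 e2 :: "real \<Rightarrow> real^3" and r :: "real \<Rightarrow> real"
    and X :: "real \<Rightarrow> real \<Rightarrow> real^3"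
  assumes m: "m \<noteq> 0" "m \<noteq> 1"
    and J: "\<alpha> < \<beta>"
    and param: "cyclic_param {a<..<b} {\<alpha><..<\<beta>} c r e1 e2 X"
    and kappa: "\<forall>s\<in>{a<..<b}. \<forall>t\<in>{\<alpha><..<\<beta>}. kappa1 X s t = m * kappa2 X s t"
begin

abbreviation "I \<equiv> {a<..<b}"
abbreviation "c1 \<equiv> vec_deriv c"
abbreviation "c2 \<equiv> vec_deriv c1"
abbreviation "d1 \<equiv> vec_deriv e1"
abbreviation "d2 \<equiv> vec_deriv e2"
abbreviation "dd1 \<equiv> vec_deriv d1"
abbreviation "dd2 \<equiv> vec_deriv d2"
abbreviation "r1 \<equiv> deriv r"
abbreviation "r2 \<equiv> deriv r1"

definition nv where "nv s = cross3 (e1 s) (e2 s)"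
definition \<omega> where "\<omega> s = d1 s \<bullet> e2 s"
definition p where "p s = d1 s \<bullet> nv s"
definition q where "q s = d2 s \<bullet> nv s"
definition A where "A s = c1 s \<bullet> e1 s"
definition B where "B s = c1 s \<bullet> e2 s"
definition C where "C s = c1 s \<bullet> nv s"
text \<open>Here and below the rotation \<open>\<omega>\<close> of the frame within its plane is
  split off: p' = p1 + \<omega> q, A' = A1 + \<omega> B, and likewise for the others.\<close>

definition p1 where "p1 s = dd1 s \<bullet> nv s - 2 * \<omega> s * q s"
definition q1 where "q1 s = dd2 s \<bullet> nv s + 2 * \<omega> s * p s"
definition A1 where "A1 s = c2 s \<bullet> e1 s + p s * C s"
definition B1 where "B1 s = c2 s \<bullet> e2 s + q s * C s"
definition C1 where "C1 s = c2 s \<bullet> nv s - p s * A s - q s * B s"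

lemma derivs:
  assumes "s \<in> I"
  shows "(c has_vector_derivative c1 s) (at s)" "(c1 has_vector_derivative c2 s) (at s)"
    "(e1 has_vector_derivative d1 s) (at s)" "(d1 has_vector_derivative dd1 s) (at s)"
    "(e2 has_vector_derivative d2 s) (at s)" "(d2 has_vector_derivative dd2 s) (at s)"
    "(r has_real_derivative r1 s) (at s)" "(r1 has_real_derivative r2 s) (at s)"
proof -
  have sm: "smooth_curve_on I c" "smooth_curve_on I e1" "smooth_curve_on I e2" "smooth_real_on I r"
    using param by (simp_all add: cyclic_param_def)
  show "(c has_vector_derivative c1 s) (at s)" "(c1 has_vector_derivative c2 s) (at s)"
    "(e1 has_vector_derivative d1 s) (at s)" "(d1 has_vector_derivative dd1 s) (at s)"
    "(e2 has_vector_derivative d2 s) (at s)" "(d2 has_vector_derivative dd2 s) (at s)"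
    by (rule smooth_curve_derivative[OF _ assms], rule sm)+
  show "(r has_real_derivative r1 s) (at s)" "(r1 has_real_derivative r2 s) (at s)"
    by (rule smooth_real_derivative[OF sm(4) assms])+
qed

lemma pair: "s \<in> I \<Longrightarrow> orthonormal_pair (e1 s) (e2 s)"
  using param by (simp add: cyclic_param_def orthonormal_pair_def)

lemma r_pos: "s \<in> I \<Longrightarrow> r s > 0"
  using param by (simp add: cyclic_param_def)

lemma near: "s \<in> I \<Longrightarrow> \<forall>\<^sub>F x in nhds s. x \<in> I"
  using eventually_nhds_in_open[of I s] by simp

lemma inner_const_derivative:
  assumes "s \<in> I" "\<And>x. x \<in> I \<Longrightarrow> f x \<bullet> g x = k"
    and "(f has_vector_derivative f') (at s)" "(g has_vector_derivative g') (at s)"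
  shows "f s \<bullet> g' + f' \<bullet> g s = 0"
  by (rule derivative_zero_if_eventually[OF has_real_derivative_inner[OF assms(3,4)]
      eventually_mono[OF near[OF assms(1)] assms(2)]])

lemma frame_derivative:
  assumes s: "s \<in> I"
  shows "d1 s \<bullet> e1 s = 0" "d2 s \<bullet> e2 s = 0" "d2 s \<bullet> e1 s = - \<omega> s"
    and "dd1 s \<bullet> e1 s = - (d1 s \<bullet> d1 s)" "dd2 s \<bullet> e2 s = - (d2 s \<bullet> d2 s)"
    and "dd1 s \<bullet> e2 s + dd2 s \<bullet> e1 s = - 2 * (d1 s \<bullet> d2 s)"
proof -
  have o: "e1 x \<bullet> e1 x = 1" "e2 x \<bullet> e2 x = 1" "e1 x \<bullet> e2 x = 0" if "x \<in> I" for x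
    using pair[OF that] by (simp_all add: orthonormal_pair_def)
  have 1: "d1 x \<bullet> e1 x = 0" if "x \<in> I" for x
    using inner_const_derivative[OF that o(1) derivs(3,3)[OF that]] by (simp add: inner_commute)
  have 2: "d2 x \<bullet> e2 x = 0" if "x \<in> I" for x
    using inner_const_derivative[OF that o(2) derivs(5,5)[OF that]] by (simp add: inner_commute)
  have 3: "e1 x \<bullet> d2 x + d1 x \<bullet> e2 x = 0" if "x \<in> I" for x
    using inner_const_derivative[OF that o(3) derivs(3,5)[OF that]] .
  show "d1 s \<bullet> e1 s = 0" "d2 s \<bullet> e2 s = 0" "d2 s \<bullet> e1 s = - \<omega> s"
    using 1[OF s] 2[OF s] 3[OF s] by (simp_all add: \<omega>_def inner_commute[of "e1 s"] add_eq_0_iff2)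
  show "dd1 s \<bullet> e1 s = - (d1 s \<bullet> d1 s)"
    using inner_const_derivative[OF s 1 derivs(4,3)[OF s]] by (simp add: add_eq_0_iff)
  show "dd2 s \<bullet> e2 s = - (d2 s \<bullet> d2 s)"
    using inner_const_derivative[OF s 2 derivs(6,5)[OF s]] by (simp add: add_eq_0_iff)
  have "((\<lambda>x. e1 x \<bullet> d2 x + d1 x \<bullet> e2 x) has_real_derivative
      (e1 s \<bullet> dd2 s + d1 s \<bullet> d2 s) + (d1 s \<bullet> d2 s + dd1 s \<bullet> e2 s)) (at s)"
    by (intro DERIV_add has_real_derivative_inner derivs s)
  from derivative_zero_if_eventually[OF this eventually_mono[OF near[OF s] 3]]
  show "dd1 s \<bullet> e2 s + dd2 s \<bullet> e1 s = - 2 * (d1 s \<bullet> d2 s)"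
    by (simp add: inner_commute[of "e1 s"])
qed

lemma residual:
  assumes s: "s \<in> I" and t: "t \<in> {\<alpha><..<\<beta>}"
  shows "weingarten_residual m (r s) (r1 s) (r2 s) (p s) (q s) (p1 s) (q1 s) (A s) (B s) (A1 s) (B1 s)
    (C s) (C1 s) (cos t) (sin t) = 0"
proof -
  interpret orthonormal_pair "e1 s" "e2 s" by (rule pair[OF s])
  have N: "N = nv s" by (simp add: N_def nv_def)
  have X: "X x y = c x + r x *\<^sub>R (cos y *\<^sub>R e1 x + sin y *\<^sub>R e2 x)" for x y
    using param by (simp add: cyclic_param_def)
  have xs: "Xs X x y = c1 x + r1 x *\<^sub>R (cos y *\<^sub>R e1 x + sin y *\<^sub>R e2 x)
      + r x *\<^sub>R (cos y *\<^sub>R d1 x + sin y *\<^sub>R d2 x)" if "x \<in> I" for x y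
    unfolding Xs_def X by (intro vector_derivative_at circle_derivative derivs that)
  have xt: "Xt X x y = r x *\<^sub>R (- sin y *\<^sub>R e1 x + cos y *\<^sub>R e2 x)" for x y
    unfolding Xt_def X
    using angle_derivative[of "c x" "r x" "e1 x" "e2 x" 0 0 0 y] by (intro vector_derivative_at) simp
  \<comment> \<open>\<open>Xs\<close> is again of the form centre plus radius times circle, with
    centre c1 + r1 (cos t e1 + sin t e2), so the same rule applies at both levels.\<close>
  have "((\<lambda>u. (c1 u + r1 u *\<^sub>R (cos t *\<^sub>R e1 u + sin t *\<^sub>R e2 u)) + r u *\<^sub>R (cos t *\<^sub>R d1 u + sin t *\<^sub>R d2 u))
    has_vector_derivative
      (c2 s + r2 s *\<^sub>R (cos t *\<^sub>R e1 s + sin t *\<^sub>R e2 s) + r1 s *\<^sub>R (cos t *\<^sub>R d1 s + sin t *\<^sub>R d2 s))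
      + r1 s *\<^sub>R (cos t *\<^sub>R d1 s + sin t *\<^sub>R d2 s) + r s *\<^sub>R (cos t *\<^sub>R dd1 s + sin t *\<^sub>R dd2 s)) (at s)"
    by (intro circle_derivative derivs s)
  then have "((\<lambda>u. Xs X u t) has_vector_derivative
      (c2 s + r2 s *\<^sub>R (cos t *\<^sub>R e1 s + sin t *\<^sub>R e2 s) + r1 s *\<^sub>R (cos t *\<^sub>R d1 s + sin t *\<^sub>R d2 s))
      + r1 s *\<^sub>R (cos t *\<^sub>R d1 s + sin t *\<^sub>R d2 s) + r s *\<^sub>R (cos t *\<^sub>R dd1 s + sin t *\<^sub>R dd2 s)) (at s)"
    by (rule has_vector_derivative_transform_within_open[of _ _ _ I]) (use s in \<open>simp_all add: xs\<close>)
  then have xss: "Xss X s t = c2 s + r2 s *\<^sub>R (cos t *\<^sub>R e1 s + sin t *\<^sub>R e2 s)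
      + (2 * r1 s) *\<^sub>R (cos t *\<^sub>R d1 s + sin t *\<^sub>R d2 s) + r s *\<^sub>R (cos t *\<^sub>R dd1 s + sin t *\<^sub>R dd2 s)"
    unfolding Xss_def by (simp add: vector_derivative_at scaleR_2 flip: scaleR_scaleR)
  have xst: "Xst X s t = r1 s *\<^sub>R (- sin t *\<^sub>R e1 s + cos t *\<^sub>R e2 s) + r s *\<^sub>R (- sin t *\<^sub>R d1 s + cos t *\<^sub>R d2 s)"
    unfolding Xst_def xs[OF s] by (intro vector_derivative_at angle_derivative)
  have xtt: "Xtt X s t = - r s *\<^sub>R (cos t *\<^sub>R e1 s + sin t *\<^sub>R e2 s)"
    unfolding Xtt_def xt
    by (intro vector_derivative_at) (auto intro!: derivative_eq_intros simp: algebra_simps)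
  have reg: "cross3 (Xs X s t) (Xt X s t) \<noteq> 0" and k: "kappa1 X s t = m * kappa2 X s t"
    using param kappa s t by (auto simp: cyclic_param_def)
  note eq = weingarten_quadratic[OF k reg refl refl refl refl refl refl,
      unfolded xs[OF s] xt xss xst xtt]
  show ?thesis
    unfolding p_def q_def p1_def q1_def A_def B_def A1_def B1_def C_def C1_def \<omega>_def N[symmetric]
    by (rule circle_residual[OF frame_derivative(1-3)[OF s, unfolded \<omega>_def] frame_derivative(4-6)[OF s] eq])
      (use r_pos[OF s] in simp)
qed

text \<open>This ties \<open>p\<close> and \<open>q\<close> to the planes: their direction is
  stationary exactly where both vanish.\<close>

lemma nv_derivative:
  assumes s: "s \<in> I"
  shows "(nv has_vector_derivative - p s *\<^sub>R e1 s - q s *\<^sub>R e2 s) (at s)"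
proof -
  interpret orthonormal_pair "e1 s" "e2 s" by (rule pair[OF s])
  have N: "N = nv s" by (simp add: N_def nv_def)
  have 1: "d1 s = fr 0 (\<omega> s) (p s)" and 2: "d2 s = fr (- \<omega> s) 0 (q s)"
    using expand[of "d1 s"] expand[of "d2 s"] frame_derivative(1-3)[OF s]
    by (simp_all add: \<omega>_def p_def q_def N)
  have "cross3 (e1 s) (d2 s) + cross3 (d1 s) (e2 s) = fr (- p s) (- q s) 0"
    unfolding 1 2 by (subst (1 2) frame_fr) (simp only: cross_fr add_fr, simp)
  also have "\<dots> = - p s *\<^sub>R e1 s - q s *\<^sub>R e2 s" by (simp add: fr_def)
  finally show ?thesis
    using has_vector_derivative_cross3[OF derivs(3,5)[OF s]] unfolding nv_def by simp
qed

lemma coefficient_derivs: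
  assumes s: "s \<in> I"
  shows "(p has_real_derivative p1 s + \<omega> s * q s) (at s)"
    and "(q has_real_derivative q1 s - \<omega> s * p s) (at s)"
    and "(A has_real_derivative A1 s + \<omega> s * B s) (at s)"
    and "(B has_real_derivative B1 s - \<omega> s * A s) (at s)"
    and "(C has_real_derivative C1 s) (at s)"
proof -
  interpret orthonormal_pair "e1 s" "e2 s" by (rule pair[OF s])
  have N: "N = nv s" by (simp add: N_def nv_def)
  have 1: "d1 s = fr 0 (\<omega> s) (p s)" and 2: "d2 s = fr (- \<omega> s) 0 (q s)"
    and c: "c1 s = fr (A s) (B s) (C s)"
    using expand[of "d1 s"] expand[of "d2 s"] expand[of "c1 s"] frame_derivative(1-3)[OF s]
    by (simp_all add: \<omega>_def p_def q_def A_def B_def C_def N)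
  have n: "- p s *\<^sub>R e1 s - q s *\<^sub>R e2 s = fr (- p s) (- q s) 0" by (simp add: fr_def)
  note dn = nv_derivative[OF s, unfolded n]
  have pr: "d1 s \<bullet> fr (- p s) (- q s) 0 = - (\<omega> s * q s)" "d2 s \<bullet> fr (- p s) (- q s) 0 = \<omega> s * p s"
    "c1 s \<bullet> fr (- p s) (- q s) 0 = - (p s * A s) - q s * B s"
    "c1 s \<bullet> d1 s = \<omega> s * B s + p s * C s" "c1 s \<bullet> d2 s = q s * C s - \<omega> s * A s"
    unfolding 1 2 c inner_fr by (simp_all add: mult.commute)
  show "(p has_real_derivative p1 s + \<omega> s * q s) (at s)"
    using has_real_derivative_inner[OF derivs(4)[OF s] dn]
    by (simp add: pr p1_def algebra_simps flip: p_def)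
  show "(q has_real_derivative q1 s - \<omega> s * p s) (at s)"
    using has_real_derivative_inner[OF derivs(6)[OF s] dn]
    by (simp add: pr q1_def algebra_simps flip: q_def)
  show "(C has_real_derivative C1 s) (at s)"
    using has_real_derivative_inner[OF derivs(2)[OF s] dn]
    by (simp add: pr C1_def algebra_simps flip: C_def)
  show "(A has_real_derivative A1 s + \<omega> s * B s) (at s)"
    using has_real_derivative_inner[OF derivs(2,3)[OF s]]
    by (simp add: pr A1_def algebra_simps flip: A_def)
  show "(B has_real_derivative B1 s - \<omega> s * A s) (at s)"
    using has_real_derivative_inner[OF derivs(2,5)[OF s]]
    by (simp add: pr B1_def algebra_simps flip: B_def)
qed

text \<open>Factor a^2 + r^2 \<pi>^2 = (a + ir\<pi>)(a - ir\<pi>); the two factors give the two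
  signs.\<close>

lemma tangency:
  assumes s: "s \<in> I" and "(p s)^2 + (q s)^2 \<noteq> 0"
  obtains \<epsilon> where "\<epsilon>^2 = 1" "A s = \<epsilon> * r s * q s" "B s = - \<epsilon> * r s * p s"
proof -
  let ?z = "of_real :: real \<Rightarrow> complex"
  have z: "?z m \<noteq> 1" "?z (r s) \<noteq> 0" "?z (p s) + \<i> * ?z (q s) \<noteq> 0"
    using m r_pos[OF s] assms(2) by (auto simp: complex_eq_iff)
  define u w where "u = ?z (A s) + \<i> * ?z (B s)" and "w = ?z (p s) + \<i> * ?z (q s)"
  have "u^2 + (?z (r s))^2 * w^2 = 0"
    unfolding u_def w_def
    by (rule leading_coefficient[OF residual_extends[OF J _ residual[OF s]] z])
  then have "(u + \<i> * ?z (r s) * w) * (u - \<i> * ?z (r s) * w) = 0"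
    by (simp add: algebra_simps power2_eq_square)
  then have "u = - (\<i> * ?z (r s) * w) \<or> u = \<i> * ?z (r s) * w"
    by (auto simp: add_eq_0_iff2)
  then have "(A s = 1 * r s * q s \<and> B s = - 1 * r s * p s) \<or> (A s = (-1) * r s * q s \<and> B s = - (-1) * r s * p s)"
    by (auto simp: u_def w_def complex_eq_iff)
  then show ?thesis using that[of 1] that[of "-1"] by auto
qed

lemma near_nonzero:
  assumes s: "s \<in> I" and "(p s)^2 + (q s)^2 \<noteq> 0"
  shows "\<forall>\<^sub>F x in nhds s. x \<in> I \<and> (p x)^2 + (q x)^2 \<noteq> 0"
proof -
  have "isCont (\<lambda>x. (p x)^2 + (q x)^2) s"
    using coefficient_derivs(1,2)[OF s, THEN DERIV_isCont] by (intro continuous_intros)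
  then have "((\<lambda>x. (p x)^2 + (q x)^2) \<longlongrightarrow> (p s)^2 + (q s)^2) (nhds s)"
    unfolding isCont_def by (rule tendsto_at_iff_tendsto_nhds[THEN iffD1])
  from tendsto_imp_eventually_ne[OF this assms(2)] near[OF s]
  show ?thesis by eventually_elim simp
qed

lemma rigid:
  assumes s: "s \<in> I" and nz: "(p s)^2 + (q s)^2 \<noteq> 0"
  shows "r1 s = 0" "C s = 0" "r2 s \<noteq> 0 \<or> C1 s \<noteq> 0"
proof -
  obtain \<epsilon> where e: "\<epsilon>^2 = 1" "A s = \<epsilon> * r s * q s" "B s = - \<epsilon> * r s * p s"
    using tangency[OF s nz] .
  \<comment> \<open>\<open>f\<close> and 2 \<open>g\<close> are the real and imaginary parts of a^2
    + r^2 \<pi>^2. They vanish near \<open>s\<close> whichever sign holds at each point.\<close>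
  define f where "f x = (A x)^2 - (B x)^2 + (r x)^2 * ((p x)^2 - (q x)^2)" for x
  define g where "g x = A x * B x + (r x)^2 * (p x * q x)" for x
  have fg: "f x = 0 \<and> g x = 0" if x: "x \<in> I \<and> (p x)^2 + (q x)^2 \<noteq> 0" for x
  proof -
    obtain \<epsilon> where "\<epsilon>^2 = 1" "A x = \<epsilon> * r x * q x" "B x = - \<epsilon> * r x * p x"
      using tangency x by blast
    then show ?thesis unfolding f_def g_def by algebra
  qed
  have ev: "\<forall>\<^sub>F x in nhds s. f x = 0" "\<forall>\<^sub>F x in nhds s. g x = 0"
    using near_nonzero[OF s nz] fg by (auto elim: eventually_mono)
  define A' B' p' q' where "A' = A1 s + \<omega> s * B s" and "B' = B1 s - \<omega> s * A s"
    and "p' = p1 s + \<omega> s * q s" and "q' = q1 s - \<omega> s * p s"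
  have D: "(p has_real_derivative p') (at s)" "(q has_real_derivative q') (at s)"
    "(A has_real_derivative A') (at s)" "(B has_real_derivative B') (at s)"
    "(r has_real_derivative r1 s) (at s)"
    using coefficient_derivs[OF s] derivs(7)[OF s] by (simp_all add: A'_def B'_def p'_def q'_def)
  have "(f has_real_derivative 2 * (A s * A' - B s * B' + r s * r1 s * ((p s)^2 - (q s)^2)
      + (r s)^2 * (p s * p' - q s * q'))) (at s)"
    unfolding f_def by (auto intro!: derivative_eq_intros D simp: algebra_simps power2_eq_square)
  then have 1: "A s * A' - B s * B' + r s * r1 s * ((p s)^2 - (q s)^2)
      + (r s)^2 * (p s * p' - q s * q') = 0"
    using derivative_zero_if_eventually ev(1) by fastforce
  have "(g has_real_derivative A' * B s + A s * B' + 2 * r s * r1 s * p s * q s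
      + (r s)^2 * (p' * q s + p s * q')) (at s)"
    unfolding g_def by (auto intro!: derivative_eq_intros D simp: algebra_simps power2_eq_square)
  then have 2: "A' * B s + A s * B' + 2 * r s * r1 s * p s * q s
      + (r s)^2 * (p' * q s + p s * q') = 0"
    using derivative_zero_if_eventually ev(2) by blast
  have r: "r s > 0" "r s \<noteq> 0" using r_pos[OF s] by simp_all
  \<comment> \<open>The \<omega>-terms cancel because (A, B) and (q, -p) rotate alike.\<close>
  have "A1 s = \<epsilon> * (r1 s * q s + r s * q1 s)" "B1 s = - \<epsilon> * (r1 s * p s + r s * p1 s)"
    using tangency_derivative[OF e(2,3,1) r(2) nz 1 2] e(2,3)
    unfolding A'_def B'_def p'_def q'_def by (simp_all add: algebra_simps)
  note rigidity[OF m(1) r(1) nz J residual[OF s] e this]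
  then show "r1 s = 0" "C s = 0" "r2 s \<noteq> 0 \<or> C1 s \<noteq> 0" by blast+
qed

text \<open>Where the plane turns, it turns on a neighbourhood; there \<open>r1\<close> and
  \<open>C\<close> vanish identically, hence so do their derivatives, against the last part of
  \<open>rigid\<close>.\<close>

lemma planes_fixed:
  assumes s: "s \<in> I"
  shows "p s = 0" "q s = 0"
proof -
  have "(p s)^2 + (q s)^2 = 0"
  proof (rule ccontr)
    assume nz: "(p s)^2 + (q s)^2 \<noteq> 0"
    have "\<forall>\<^sub>F x in nhds s. r1 x = 0 \<and> C x = 0"
      using near_nonzero[OF s nz] by (rule eventually_mono) (use rigid(1,2) in blast)
    then have "\<forall>\<^sub>F x in nhds s. r1 x = 0" "\<forall>\<^sub>F x in nhds s. C x = 0"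
      by (simp_all add: eventually_conj_iff)
    then have "r2 s = 0" "C1 s = 0"
      by (auto intro: derivative_zero_if_eventually derivs(8)[OF s] coefficient_derivs(5)[OF s])
    with rigid(3)[OF s nz] show False by simp
  qed
  then show "p s = 0" "q s = 0" by simp_all
qed

lemma normal_constant:
  assumes "s \<in> I" "s' \<in> I"
  shows "nv s = nv s'"
proof -
  have *: "(nv has_vector_derivative 0) (at x within I)" if "x \<in> I" for x
    using nv_derivative[OF that] planes_fixed[OF that] by (simp add: has_vector_derivative_at_within)
  obtain v where "\<And>x. x \<in> I \<Longrightarrow> nv x = v"
    by (rule has_vector_derivative_zero_constant[OF convex_real_interval(8) *]) blast+
  with assms show ?thesis by simp
qed

end

theorem theorem1:
  fixes m a b \<alpha> \<beta> :: real
    and c e1 e2 :: "real \<Rightarrow> real^3" and r :: "real \<Rightarrow> real"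
    and X :: "real \<Rightarrow> real \<Rightarrow> real^3"
  assumes "m \<noteq> 0" and "m \<noteq> 1"
    and "a < b" and "\<alpha> < \<beta>"
    and "cyclic_param {a<..<b} {\<alpha><..<\<beta>} c r e1 e2 X"
    and "\<forall>s\<in>{a<..<b}. \<forall>t\<in>{\<alpha><..<\<beta>}. kappa1 X s t = m * kappa2 X s t"
  shows "\<forall>s\<in>{a<..<b}. \<forall>s'\<in>{a<..<b}. cross3 (cross3 (e1 s) (e2 s)) (cross3 (e1 s') (e2 s')) = 0"
proof (intro ballI)
  fix s s' assume s: "s \<in> {a<..<b}" "s' \<in> {a<..<b}"
  interpret cyclic_weingarten m a b \<alpha> \<beta> c e1 e2 r X
    using assms by unfold_locales
  \<comment> \<open>Parallelism is expressed by a vanishing cross product of normals; the normals in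
    fact coincide.\<close>
  have "nv s = nv s'" using s by (rule normal_constant)
  then show "cross3 (cross3 (e1 s) (e2 s)) (cross3 (e1 s') (e2 s')) = 0"
    by (simp add: nv_def)
qed

end
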